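(* Let $V$ be a vertex operator algebra and let $W$ be a weak $V$-module. Then $D(W)$, equipped with the vertex operator map $Y^*$, is a weak $V$-module.
   Context: All vector spaces are over $\mathbb{C}$. A vertex operator algebra $V=\coprod_{n\in\mathbb{Z}}V_{(n)}$ is meant in the standard sense of Frenkel–Huang–Lepowsky: $Y(v,x)=\sum_{n\in\mathbb{Z}}v_nx^{-n-1}$, vacuum $\mathbf{1}$, $Y(\omega,x)=\sum_n L(n)x^{-n-2}$, $V_{(n)}$ is the $L(0)$-eigenspace of eigenvalue $n$, $\dim V_{(n)}<\infty$, $V_{(n)}=0$ for $n$ sufficiently negative. A weak $V$-module is a vector space $W$ with a linear map $v\mapsto Y(v,x)=\sum_n v_nx^{-n-1}\in(\mathrm{End}\,W)[[x,x^{-1}]]$ satisfying $Y(v,x)w\in W((x))$, $Y(\mathbf{1},x)=\mathrm{id}_W$ and the Jacobi identity (no grading required). For $v\in V$ and $\alpha\in W^*$ (full linear dual) define $Y^*(v,x)\alpha=\sum_{n\in\mathbb{Z}}(v^*_n\alpha)x^{-n-1}$ by $$\langle Y^*(v,x)\alpha,w\rangle=\left\langle\alpha,Y\left(e^{xL(1)}(-x^{-2})^{L(0)}v,x^{-1}\right)w\right\rangle,\quad w\in W.$$ $D(W)$ is the subspace of all $\alpha\in W^*$ such that $Y^*(v,x)\alpha\in W^*((x))$ for every $v\in V$, i.e. $v^*_n\alpha=0$ for $n$ sufficiently large (depending on $v$). *)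

theory Defs
  imports Complex_Main "HOL-Library.Groups_Big_Fun" "HOL-Library.Function_Algebras"
begin

section \<open>Formal series\<close>

text \<open>
  A formal series in \<open>x\<^sub>0, x\<^sub>1, x\<^sub>2\<close> is the function sending \<open>(a, b, c)\<close> to the
  coefficient of \<open>x\<^sub>0\<^sup>a x\<^sub>1\<^sup>b x\<^sub>2\<^sup>c\<close>. Infinite sums over exponents are written with
  \<^const>\<open>Sum_any\<close>, which is the algebraic sum when only finitely many terms are nonzero
  (and 0 otherwise). In all uses below the lower truncation condition (or finiteness of the
  weight decomposition) makes the sums finite.
\<close>

type_synonym 'a series3 = "int \<times> int \<times> int \<Rightarrow> 'a"

definition series_mult ::
    "(complex \<Rightarrow> 'w \<Rightarrow> 'w) \<Rightarrow> complex series3 \<Rightarrow> 'w::ab_group_add series3 \<Rightarrow> 'w series3" where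
  "series_mult scale f g =
     (\<lambda>(a, b, c). Sum_any (\<lambda>(i, j, k). scale (f (i, j, k)) (g (a - i, b - j, c - k))))"

text \<open>
  Coefficient of \<open>s\<^sup>i t\<^sup>j\<close> in \<open>(s - t)\<^sup>n\<close>, expanded in nonnegative powers of the second
  variable \<open>t\<close>.
\<close>

definition binomial_coeff :: "int \<Rightarrow> int \<Rightarrow> int \<Rightarrow> complex" where
  "binomial_coeff n i j =
     (if j \<ge> 0 \<and> i + j = n then (-1) ^ nat j * ((of_int n :: complex) gchoose nat j) else 0)"

text \<open>With \<open>\<delta>(x) = (\<Sum>n\<in>\<int>. x\<^sup>n)\<close>, the next three series are
  \<open>x\<^sub>0\<^sup>-\<^sup>1 \<delta>((x\<^sub>1 - x\<^sub>2) / x\<^sub>0)\<close>,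
  \<open>x\<^sub>0\<^sup>-\<^sup>1 \<delta>((x\<^sub>2 - x\<^sub>1) / (- x\<^sub>0))\<close> and
  \<open>x\<^sub>2\<^sup>-\<^sup>1 \<delta>((x\<^sub>1 - x\<^sub>0) / x\<^sub>2)\<close>.\<close>

definition delta_12_0 :: "complex series3" where
  "delta_12_0 = (\<lambda>(a, b, c). binomial_coeff (- a - 1) b c)"

definition delta_21_0 :: "complex series3" where
  "delta_21_0 = (\<lambda>(a, b, c). (-1) powi (- a - 1) * binomial_coeff (- a - 1) c b)"

definition delta_10_2 :: "complex series3" where
  "delta_10_2 = (\<lambda>(a, b, c). binomial_coeff (- c - 1) b a)"

section \<open>Vertex operators and the Jacobi identity\<close>

text \<open>
  A vertex operator map is given by its modes: \<open>Y v n\<close> is \<open>v\<^sub>n\<close>, so that the coefficient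
  of \<open>x\<^sup>m\<close> in \<open>Y(v, x)\<close> is \<open>Y v (- m - 1)\<close>.
\<close>

type_synonym ('v, 'w) vertex_map = "'v \<Rightarrow> int \<Rightarrow> 'w \<Rightarrow> 'w"

text \<open>\<open>Y(u, x\<^sub>1) Y(v, x\<^sub>2) w\<close>, \<open>Y(v, x\<^sub>2) Y(u, x\<^sub>1) w\<close> and \<open>Y(Y(u, x\<^sub>0) v, x\<^sub>2) w\<close>:\<close>

definition prod_uv :: "('v, 'w::zero) vertex_map \<Rightarrow> 'v \<Rightarrow> 'v \<Rightarrow> 'w \<Rightarrow> 'w series3" where
  "prod_uv Y u v w = (\<lambda>(a, b, c). if a = 0 then Y u (- b - 1) (Y v (- c - 1) w) else 0)"

definition prod_vu :: "('v, 'w::zero) vertex_map \<Rightarrow> 'v \<Rightarrow> 'v \<Rightarrow> 'w \<Rightarrow> 'w series3" where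
  "prod_vu Y u v w = (\<lambda>(a, b, c). if a = 0 then Y v (- c - 1) (Y u (- b - 1) w) else 0)"

definition iterate_uv ::
    "('v, 'v) vertex_map \<Rightarrow> ('v, 'w::zero) vertex_map \<Rightarrow> 'v \<Rightarrow> 'v \<Rightarrow> 'w \<Rightarrow> 'w series3" where
  "iterate_uv YV Y u v w =
     (\<lambda>(a, b, c). if b = 0 then Y (YV u (- a - 1) v) (- c - 1) w else 0)"

definition jacobi_identity ::
    "('v, 'v) vertex_map \<Rightarrow> (complex \<Rightarrow> 'w \<Rightarrow> 'w) \<Rightarrow> ('v, 'w::ab_group_add) vertex_map
      \<Rightarrow> 'v \<Rightarrow> 'v \<Rightarrow> 'w \<Rightarrow> bool" where
  "jacobi_identity YV scaleW Y u v w \<longleftrightarrow>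
     series_mult scaleW delta_12_0 (prod_uv Y u v w)
       - series_mult scaleW delta_21_0 (prod_vu Y u v w)
     = series_mult scaleW delta_10_2 (iterate_uv YV Y u v w)"

section \<open>Vertex operator algebras\<close>

definition virasoro :: "('v, 'v) vertex_map \<Rightarrow> 'v \<Rightarrow> int \<Rightarrow> 'v \<Rightarrow> 'v" where
  "virasoro Y \<omega> n = Y \<omega> (n + 1)"

definition weight_space ::
    "(complex \<Rightarrow> 'v \<Rightarrow> 'v) \<Rightarrow> ('v, 'v) vertex_map \<Rightarrow> 'v \<Rightarrow> int \<Rightarrow> 'v set" where
  "weight_space scale Y \<omega> n = {v. virasoro Y \<omega> 0 v = scale (of_int n) v}"

definition weight_decomposition ::
    "(complex \<Rightarrow> 'v \<Rightarrow> 'v) \<Rightarrow> ('v, 'v) vertex_map \<Rightarrow> 'v::ab_group_add \<Rightarrow> 'v \<Rightarrow> (int \<Rightarrow> 'v) \<Rightarrow> bool"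
  where
  "weight_decomposition scale Y \<omega> v f \<longleftrightarrow>
     (\<forall>n. f n \<in> weight_space scale Y \<omega> n) \<and> finite {n. f n \<noteq> 0} \<and> v = Sum_any f"

locale vertex_operator_algebra = vector_space scale
  for scale :: "complex \<Rightarrow> 'v::ab_group_add \<Rightarrow> 'v" +
  fixes Y :: "('v, 'v) vertex_map"
    and vac :: 'v
    and \<omega> :: 'v
    and c :: complex
  assumes linear_Y: "Vector_Spaces.linear scale scale (\<lambda>v. Y v n u)"
    and linear_mode: "Vector_Spaces.linear scale scale (Y v n)"
    and truncation: "\<exists>N. \<forall>n\<ge>N. Y u n v = 0"
    and vacuum: "Y vac n v = (if n = - 1 then v else 0)"
    and creation: "n \<ge> 0 \<Longrightarrow> Y v n vac = 0" "Y v (- 1) vac = v"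
    and jacobi: "jacobi_identity Y scale Y u v w"
    and virasoro_relations:
      "virasoro Y \<omega> m (virasoro Y \<omega> n v) - virasoro Y \<omega> n (virasoro Y \<omega> m v) =
         scale (of_int (m - n)) (virasoro Y \<omega> (m + n) v)
         + (if m + n = 0 then scale (of_int (m ^ 3 - m) / 12 * c) v else 0)"
      \<comment> \<open>\<open>Y(L(-1) v, x) = d/dx Y(v, x)\<close>\<close>
    and translation: "Y (virasoro Y \<omega> (- 1) v) n u = scale (- of_int n) (Y v (n - 1) u)"
    and direct_sum: "\<exists>!f. weight_decomposition scale Y \<omega> v f"
    and finite_dim: "\<exists>B. finite B \<and> span B = weight_space scale Y \<omega> n"
    and bounded_below: "\<exists>N. \<forall>n<N. weight_space scale Y \<omega> n = {0}"

section \<open>Weak modules\<close>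

text \<open>
  The underlying space of the module is a linear subspace \<open>W\<close> of an ambient space \<open>'w\<close>, and
  the values of the operators outside \<open>W\<close> are irrelevant. In the case \<open>W = UNIV\<close> the module
  is the whole type. The parameters \<open>scaleV\<close>, \<open>YV\<close>, \<open>vac\<close> are those of the vertex operator algebra.
\<close>

locale weak_module = vector_space scaleW
  for scaleV :: "complex \<Rightarrow> 'v::ab_group_add \<Rightarrow> 'v"
    and YV :: "('v, 'v) vertex_map"
    and vac :: 'v
    and scaleW :: "complex \<Rightarrow> 'w::ab_group_add \<Rightarrow> 'w" +
  fixes W :: "'w set"
    and Y :: "('v, 'w) vertex_map"
  assumes subspace_W: "subspace W"
    and mode_closed: "w \<in> W \<Longrightarrow> Y v n w \<in> W"
    and mode_add: "\<lbrakk>w \<in> W; w' \<in> W\<rbrakk> \<Longrightarrow> Y v n (w + w') = Y v n w + Y v n w'"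
    and mode_scale: "w \<in> W \<Longrightarrow> Y v n (scaleW a w) = scaleW a (Y v n w)"
    and Y_add: "w \<in> W \<Longrightarrow> Y (v + v') n w = Y v n w + Y v' n w"
    and Y_scale: "w \<in> W \<Longrightarrow> Y (scaleV a v) n w = scaleW a (Y v n w)"
    and truncation: "w \<in> W \<Longrightarrow> \<exists>N. \<forall>n\<ge>N. Y v n w = 0"
    and vacuum: "w \<in> W \<Longrightarrow> Y vac n w = (if n = - 1 then w else 0)"
    and jacobi: "w \<in> W \<Longrightarrow> jacobi_identity YV scaleW Y u v w"

section \<open>The dual vertex operator map and \<open>D(W)\<close>\<close>

definition weight_component ::
    "(complex \<Rightarrow> 'v \<Rightarrow> 'v) \<Rightarrow> ('v, 'v) vertex_map \<Rightarrow> 'v::ab_group_add \<Rightarrow> int \<Rightarrow> 'v \<Rightarrow> 'v" where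
  "weight_component scale Y \<omega> n v = (THE f. weight_decomposition scale Y \<omega> v f) n"

text \<open>
  Coefficient of \<open>x\<^sup>q\<close> in \<open>(-x\<^sup>-\<^sup>2)\<^sup>L\<^sup>(\<^sup>0\<^sup>) v\<close>: the component of weight \<open>k\<close> contributes
  \<open>(-1)\<^sup>k\<close> times itself, at \<open>q = -2 k\<close>.
\<close>

definition L0_power_coeff ::
    "(complex \<Rightarrow> 'v \<Rightarrow> 'v) \<Rightarrow> ('v, 'v) vertex_map \<Rightarrow> 'v::ab_group_add \<Rightarrow> 'v \<Rightarrow> int \<Rightarrow> 'v" where
  "L0_power_coeff scale Y \<omega> v q =
     (if even q
      then scale ((-1) powi (- (q div 2))) (weight_component scale Y \<omega> (- (q div 2)) v)
      else 0)"

text \<open>Coefficient of \<open>x\<^sup>p\<close> in \<open>e\<^bsup>xL(1)\<^esup> (-x\<^sup>-\<^sup>2)\<^sup>L\<^sup>(\<^sup>0\<^sup>) v\<close>.\<close>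

definition opposite_coeff ::
    "(complex \<Rightarrow> 'v \<Rightarrow> 'v) \<Rightarrow> ('v, 'v) vertex_map \<Rightarrow> 'v::ab_group_add \<Rightarrow> 'v \<Rightarrow> int \<Rightarrow> 'v" where
  "opposite_coeff scale Y \<omega> v p =
     Sum_any (\<lambda>j::nat. scale (1 / fact j)
       ((virasoro Y \<omega> 1 ^^ j) (L0_power_coeff scale Y \<omega> v (p - int j))))"

text \<open>
  \<open>v\<^sup>*\<^sub>n \<alpha>\<close>: the coefficient of \<open>x\<^sup>-\<^sup>n\<^sup>-\<^sup>1\<close> in
  \<open>\<langle>\<alpha>, Y(e\<^bsup>xL(1)\<^esup> (-x\<^sup>-\<^sup>2)\<^sup>L\<^sup>(\<^sup>0\<^sup>) v, x\<^sup>-\<^sup>1) w\<rangle>\<close>. If \<open>u\<close> is the coefficient of \<open>x\<^sup>p\<close> in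
  the argument of \<open>Y\<close>, then \<open>u\<^sub>m\<close> occurs with \<open>x\<^sup>p\<^sup>+\<^sup>m\<^sup>+\<^sup>1\<close>, whence \<open>m = - n - 2 - p\<close>.
\<close>

definition dual_vertex_map ::
    "(complex \<Rightarrow> 'v \<Rightarrow> 'v) \<Rightarrow> ('v, 'v) vertex_map \<Rightarrow> 'v::ab_group_add
      \<Rightarrow> ('v, 'w::ab_group_add) vertex_map \<Rightarrow> ('v, 'w \<Rightarrow> complex) vertex_map" where
  "dual_vertex_map scaleV YV \<omega> Y v n \<alpha> =
     (\<lambda>w. \<alpha> (Sum_any (\<lambda>p. Y (opposite_coeff scaleV YV \<omega> v p) (- n - 2 - p) w)))"

definition dual_space :: "(complex \<Rightarrow> 'w::ab_group_add \<Rightarrow> 'w) \<Rightarrow> ('w \<Rightarrow> complex) set" where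
  "dual_space scaleW = {\<alpha>. Vector_Spaces.linear scaleW (*) \<alpha>}"

definition dual_scale :: "complex \<Rightarrow> ('w \<Rightarrow> complex) \<Rightarrow> 'w \<Rightarrow> complex" where
  "dual_scale a \<alpha> = (\<lambda>w. a * \<alpha> w)"

definition D ::
    "(complex \<Rightarrow> 'v \<Rightarrow> 'v) \<Rightarrow> ('v, 'v) vertex_map \<Rightarrow> 'v::ab_group_add
      \<Rightarrow> (complex \<Rightarrow> 'w \<Rightarrow> 'w) \<Rightarrow> ('v, 'w::ab_group_add) vertex_map \<Rightarrow> ('w \<Rightarrow> complex) set" where
  "D scaleV YV \<omega> scaleW Y =
     {\<alpha> \<in> dual_space scaleW.
        \<forall>v. \<exists>N. \<forall>n\<ge>N. dual_vertex_map scaleV YV \<omega> Y v n \<alpha> = 0}"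

end

theory Submission
  imports Defs "HOL-Computational_Algebra.Formal_Power_Series"
begin

text \<open>
  Comparing coefficients, the Jacobi identity is the family of Borcherds identities indexed by
  \<open>l, m, n\<close>. Write \<open>u\<^sub>(\<^sub>s\<^sub>)\<close> for \<open>L(1)\<^sup>s u / s!\<close> and \<open>v'\<^sub>n\<close> for the operator on \<open>W\<close> whose transpose is
  \<open>v\<^sup>*\<^sub>n\<close>; if \<open>v\<close> has weight \<open>b\<close>, then \<open>v'\<^sub>n\<close> is \<open>(-1)\<^sup>b\<close> times the sum over \<open>r\<close> of the modes of
  \<open>v\<^sub>(\<^sub>r\<^sub>)\<close> at \<open>2 b - r - n - 2\<close>. The commutator of \<open>L(1)\<close> with modes gives, for \<open>u\<close> of weight \<open>a\<close>, a
  Leibniz rule for \<open>(u\<^sub>n v)\<^sub>(\<^sub>j\<^sub>)\<close> with coefficients \<open>binom(2 a - s - n - 2, t)\<close>. Inserted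
  into the iterate side of the opposite Borcherds identity at \<open>(l, m, n)\<close>, it turns this side, by a
  Vandermonde convolution, into a signed sum over \<open>r, s\<close> of the iterate sides of the Borcherds identities
  of \<open>u\<^sub>(\<^sub>s\<^sub>), v\<^sub>(\<^sub>r\<^sub>)\<close> on \<open>W\<close> at \<open>(l, 2 a - s - l - 2 - m, 2 b - r - l - 2 - n)\<close>, and the other
  sides match term by term. All sums are finite after application to \<open>w\<close>, so the opposite identity
  holds on all of \<open>W\<close>. The truncation in \<open>D(W)\<close> makes the transposed sums finite as well, and
  the case \<open>l = 0\<close> shows that \<open>D(W)\<close> is closed under the modes.
\<close>

section \<open>Finite sums\<close>

lemma Sum_any_reindex_inj:
  assumes "inj h" and "\<And>x. x \<notin> range h \<Longrightarrow> g x = 0"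
  shows "Sum_any g = Sum_any (\<lambda>y. g (h y))"
proof -
  have "{x. g x \<noteq> 0} = h ` {y. g (h y) \<noteq> 0}"
  proof (intro subset_antisym subsetI)
    fix x assume x: "x \<in> {x. g x \<noteq> 0}"
    then obtain y where "x = h y" using assms(2)[of x] by blast
    with x show "x \<in> h ` {y. g (h y) \<noteq> 0}" by blast
  qed blast
  then show ?thesis
    using inj_on_subset[OF assms(1)] by (simp only: Sum_any.expand_set sum.reindex o_def subset_UNIV)
qed

lemma Sum_any_eq_sum_lessThan:
  assumes "\<And>i. i \<ge> K \<Longrightarrow> f i = 0"
  shows "Sum_any f = (\<Sum>i<K. f (i::nat))"
  by (rule Sum_any.expand_superset) (use assms not_less in auto)

lemma sum_fun_apply: "sum f A x = (\<Sum>i\<in>A. f i x)" for f :: "'i \<Rightarrow> 'a \<Rightarrow> 'b::comm_monoid_add"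
  by (induction A rule: infinite_finite_induct) auto

text \<open>Vandermonde after two upper negations. Negating \<open>y - i\<close> in the second
  factor makes its upper entry independent of \<open>i\<close>, and negating the result turns
  \<open>q - (y - x) - 1\<close> back into \<open>y - x\<close>. This is the convolution that merges
  the sum over \<open>i\<close> of the iterate side with the Leibniz sum over
  \<open>t\<close>.\<close>

lemma sum_gbinomial_mult_gbinomial_diff:
  fixes x y :: "'a::field_char_0"
  shows "(\<Sum>i\<le>q. (-1) ^ i * (x gchoose i) * (y - of_nat i gchoose (q - i))) = (y - x gchoose q)"
proof -
  have "(-1) ^ i * (x gchoose i) * (y - of_nat i gchoose (q - i))
      = (-1) ^ q * ((x gchoose i) * (of_nat q - 1 - y gchoose (q - i)))" if "i \<le> q" for i
  proof -
    \<comment> \<open>The shifts by \<open>i\<close> cancel, so that Vandermonde becomes applicable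
      with a fixed upper entry.\<close>
    have "of_nat (q - i) - (y - of_nat i) - 1 = of_nat q - 1 - y"
      using that by (simp add: of_nat_diff)
    then have "(y - of_nat i gchoose (q - i)) = (-1) ^ (q - i) * (of_nat q - 1 - y gchoose (q - i))"
      using gbinomial_negated_upper[of "y - of_nat i" "q - i"] by metis
    moreover have "(-1::'a) ^ q = (-1) ^ i * (-1) ^ (q - i)"
      using that by (metis le_add_diff_inverse power_add)
    ultimately show ?thesis by (simp only: mult_ac)
  qed
  then have "(\<Sum>i\<le>q. (-1) ^ i * (x gchoose i) * (y - of_nat i gchoose (q - i)))
      = (\<Sum>i\<le>q. (-1) ^ q * ((x gchoose i) * (of_nat q - 1 - y gchoose (q - i))))"
    by (intro sum.cong refl) (simp only: atMost_iff)
  also have "\<dots> = (-1) ^ q * (\<Sum>i\<in>{0..q}. (x gchoose i) * (of_nat q - 1 - y gchoose (q - i)))"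
    unfolding sum_distrib_left atLeast0AtMost ..
  also have "\<dots> = (-1) ^ q * (x + (of_nat q - 1 - y) gchoose q)"
    by (simp only: gbinomial_Vandermonde)
  also have "x + (of_nat q - 1 - y) = of_nat q - (y - x) - 1"
    by simp
  also have "(-1) ^ q * (of_nat q - (y - x) - 1 gchoose q) = (y - x gchoose q)"
    by (rule gbinomial_negated_upper[symmetric])
  finally show ?thesis .
qed

lemma sum_lessThan_eq_sum:
  assumes "J \<le> K" and "\<And>i. J \<le> i \<Longrightarrow> f i = 0"
  shows "(\<Sum>i<K. f i) = (\<Sum>i<J. f (i::nat))"
  by (rule sum.mono_neutral_right) (use assms in \<open>auto simp: not_less\<close>)

text \<open>Since \<open>f\<close> vanishes from \<open>K\<close> on, the square of pairs below
  \<open>K\<close> may be cut down to the triangle \<open>i + t < K\<close>, which is then summed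
  along its diagonals.\<close>

lemma sum_convolution:
  assumes "vector_space scale" and "\<And>q. q \<ge> K \<Longrightarrow> f q = (0::'w::ab_group_add)"
  shows "(\<Sum>i<K. \<Sum>t<K. scale (g i t) (f (i + t))) = (\<Sum>q<K. scale (\<Sum>i\<le>q. g i (q - i)) (f (q::nat)))"
proof -
  interpret vector_space scale by (rule assms(1))
  have "(\<Sum>i<K. \<Sum>t<K. scale (g i t) (f (i + t)))
      = (\<Sum>(i, t)\<in>{..<K} \<times> {..<K}. scale (g i t) (f (i + t)))"
    by (simp add: sum.cartesian_product)
  also have "\<dots> = (\<Sum>(i, t) | i + t < K. scale (g i t) (f (i + t)))"
  proof (rule sum.mono_neutral_right)
    show "\<forall>x\<in>{..<K} \<times> {..<K} - {(i, t). i + t < K}. (case x of (i, t) \<Rightarrow> scale (g i t) (f (i + t))) = 0"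
    proof
      fix x assume "x \<in> {..<K} \<times> {..<K} - {(i, t). i + t < K}"
      then obtain i t where "x = (i, t)" "i + t \<ge> K" by (cases x) auto
      then show "(case x of (i, t) \<Rightarrow> scale (g i t) (f (i + t))) = 0" by (simp add: assms(2))
    qed
  qed auto
  also have "\<dots> = (\<Sum>q<K. \<Sum>i\<le>q. scale (g i (q - i)) (f (i + (q - i))))"
    by (rule sum.triangle_reindex)
  also have "\<dots> = (\<Sum>q<K. scale (\<Sum>i\<le>q. g i (q - i)) (f q))"
    by (simp add: scale_sum_left)
  finally show ?thesis .
qed

text \<open>The support lies in a box, and \<open>S + K + S \<le> J\<close> puts the whole box into
  the levels below \<open>J\<close>. Levels arise from the powers of \<open>L(1)\<close>; the box
  allows the three indices to be summed independently.\<close>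

lemma sum_level_sets:
  fixes f :: "nat \<Rightarrow> nat \<Rightarrow> nat \<Rightarrow> 'w::ab_group_add"
  assumes "S + K + S \<le> J" and "\<And>s t r. s \<ge> S \<or> t \<ge> K \<or> r \<ge> S \<Longrightarrow> f s t r = 0"
  shows "(\<Sum>j<J. \<Sum>(s, t, r) | s + t + r = j. f s t r) = (\<Sum>s<S. \<Sum>r<S. \<Sum>t<K. f s t r)"
proof -
  have "finite {(s, t, r). s + t + r = j}" for j :: nat
    by (rule finite_subset[of _ "{..j} \<times> {..j} \<times> {..j}"]) auto
  then have "(\<Sum>j<J. \<Sum>(s, t, r) | s + t + r = j. f s t r)
      = (\<Sum>(s, t, r)\<in>(\<Union>j<J. {(s, t, r). s + t + r = j}). f s t r)"
    by (subst sum.UNION_disjoint) (auto simp: split_def)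
  also have "(\<Union>j<J. {(s, t, r). s + t + r = j}) = {(s, t, r). s + t + r < J}"
    by auto
  also have "(\<Sum>(s, t, r) | s + t + r < J. f s t r) = (\<Sum>(s, t, r)\<in>{..<S} \<times> {..<K} \<times> {..<S}. f s t r)"
  proof (rule sum.mono_neutral_right)
    show "finite {(s, t, r). s + t + r < J}"
      by (rule finite_subset[of _ "{..J} \<times> {..J} \<times> {..J}"]) auto
    show "{..<S} \<times> {..<K} \<times> {..<S} \<subseteq> {(s, t, r). s + t + r < J}"
      using assms(1) by auto
    show "\<forall>x\<in>{(s, t, r). s + t + r < J} - {..<S} \<times> {..<K} \<times> {..<S}. (case x of (s, t, r) \<Rightarrow> f s t r) = 0"
    proof
      fix x assume "x \<in> {(s, t, r). s + t + r < J} - {..<S} \<times> {..<K} \<times> {..<S}"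
      then obtain s t r where "x = (s, t, r)" "s \<ge> S \<or> t \<ge> K \<or> r \<ge> S" by (cases x) auto
      then show "(case x of (s, t, r) \<Rightarrow> f s t r) = 0" using assms(2) by auto
    qed
  qed
  also have "\<dots> = (\<Sum>s<S. \<Sum>t<K. \<Sum>r<S. f s t r)"
    by (simp add: sum.cartesian_product)
  also have "\<dots> = (\<Sum>s<S. \<Sum>r<S. \<Sum>t<K. f s t r)"
    by (intro sum.cong refl sum.swap)
  finally show ?thesis .
qed

section \<open>Borcherds identities\<close>

lemma series_mult_reindex:
  fixes scale :: "complex \<Rightarrow> 'w::ab_group_add \<Rightarrow> 'w"
  assumes "inj h"
    and "\<And>i j k. (i, j, k) \<notin> range h \<Longrightarrow> scale (f (i, j, k)) (g (a - i, b - j, c - k)) = 0"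
  shows "series_mult scale f g (a, b, c) =
    Sum_any (\<lambda>y. case h y of (i, j, k) \<Rightarrow> scale (f (i, j, k)) (g (a - i, b - j, c - k)))"
  unfolding series_mult_def prod.case
  by (rule Sum_any_reindex_inj) (use assms in \<open>auto split: prod.splits\<close>)

section \<open>Coefficients of the three delta-function products\<close>

context
  fixes scale :: "complex \<Rightarrow> 'w::ab_group_add \<Rightarrow> 'w"
  assumes vs: "vector_space scale"
begin

interpretation vector_space scale by (rule vs)

text \<open>The product of modes contains no \<open>x\<^sub>0\<close>, so the delta series has to
  supply the exponent \<open>- l - 1\<close>. Only the terms of the expansion of the
  \<open>l\<close>-th power of \<open>x\<^sub>1 - x\<^sub>2\<close> survive, indexed by the exponent
  of \<open>x\<^sub>2\<close>.\<close>

lemma series_mult_delta_12_0: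
  "series_mult scale delta_12_0 (prod_uv Y u v w) (- l - 1, - m - 1, - n - 1) =
    Sum_any (\<lambda>i. scale ((-1) ^ i * (of_int l gchoose i)) (Y u (l + m - int i) (Y v (n + int i) w)))"
proof (subst series_mult_reindex[where h = "\<lambda>k::nat. (- l - 1, l - int k, int k)"])
  show "inj (\<lambda>k. (- l - 1, l - int k, int k))" by (auto simp: inj_on_def)
next
  fix i j k assume x: "(i, j, k) \<notin> range (\<lambda>k. (- l - 1, l - int k, int k))"
  show "scale (delta_12_0 (i, j, k))
          (prod_uv Y u v w (- l - 1 - i, - m - 1 - j, - n - 1 - k)) = 0"
  proof (rule ccontr)
    assume "\<not> ?thesis"
    then have "i = - l - 1" "k \<ge> 0" "j + k = l"
      by (auto simp: delta_12_0_def prod_uv_def binomial_coeff_def split: if_splits)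
    then have "(i, j, k) = (\<lambda>k. (- l - 1, l - int k, int k)) (nat k)" by auto
    with x show False by blast
  qed
next
  show "Sum_any (\<lambda>y. case (- l - 1, l - int y, int y) of (i, j, k) \<Rightarrow>
        scale (delta_12_0 (i, j, k)) (prod_uv Y u v w (- l - 1 - i, - m - 1 - j, - n - 1 - k))) =
      Sum_any (\<lambda>i. scale ((-1) ^ i * (of_int l gchoose i)) (Y u (l + m - int i) (Y v (n + int i) w)))"
    by (intro Sum_any.cong) (simp add: delta_12_0_def prod_uv_def binomial_coeff_def, simp add: algebra_simps)
qed

lemma series_mult_delta_21_0:
  "series_mult scale delta_21_0 (prod_vu Y u v w) (- l - 1, - m - 1, - n - 1) =
    Sum_any (\<lambda>i. scale ((-1) powi l * ((-1) ^ i * (of_int l gchoose i)))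
      (Y v (l + n - int i) (Y u (m + int i) w)))"
proof (subst series_mult_reindex[where h = "\<lambda>k::nat. (- l - 1, int k, l - int k)"])
  show "inj (\<lambda>k. (- l - 1, int k, l - int k))" by (auto simp: inj_on_def)
next
  fix i j k assume x: "(i, j, k) \<notin> range (\<lambda>k. (- l - 1, int k, l - int k))"
  show "scale (delta_21_0 (i, j, k))
          (prod_vu Y u v w (- l - 1 - i, - m - 1 - j, - n - 1 - k)) = 0"
  proof (rule ccontr)
    assume "\<not> ?thesis"
    then have "i = - l - 1" "j \<ge> 0" "j + k = l"
      by (auto simp: delta_21_0_def prod_vu_def binomial_coeff_def split: if_splits)
    then have "(i, j, k) = (\<lambda>k. (- l - 1, int k, l - int k)) (nat j)" by auto
    with x show False by blast
  qed
next
  show "Sum_any (\<lambda>y. case (- l - 1, int y, l - int y) of (i, j, k) \<Rightarrow>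
        scale (delta_21_0 (i, j, k)) (prod_vu Y u v w (- l - 1 - i, - m - 1 - j, - n - 1 - k))) =
      Sum_any (\<lambda>i. scale ((-1) powi l * ((-1) ^ i * (of_int l gchoose i)))
        (Y v (l + n - int i) (Y u (m + int i) w)))"
    by (intro Sum_any.cong) (simp add: delta_21_0_def prod_vu_def binomial_coeff_def, simp add: algebra_simps)
qed

text \<open>The iterate contains no \<open>x\<^sub>1\<close>, so the delta series supplies the
  exponent \<open>- m - 1\<close>. Its coefficient at the \<open>i\<close>-th power of
  \<open>x\<^sub>0\<close> is \<open>(-1)^i binom(i - m - 1, i)\<close>, which upper negation turns
  into \<open>binom(m, i)\<close>.\<close>

lemma series_mult_delta_10_2:
  "series_mult scale delta_10_2 (iterate_uv YV Y u v w) (- l - 1, - m - 1, - n - 1) =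
    Sum_any (\<lambda>i. scale (of_int m gchoose i) (Y (YV u (l + int i) v) (m + n - int i) w))"
proof (subst series_mult_reindex[where h = "\<lambda>k::nat. (int k, - m - 1, m - int k)"])
  show "inj (\<lambda>k. (int k, - m - 1, m - int k))" by (auto simp: inj_on_def)
next
  fix i j k assume x: "(i, j, k) \<notin> range (\<lambda>k. (int k, - m - 1, m - int k))"
  show "scale (delta_10_2 (i, j, k))
          (iterate_uv YV Y u v w (- l - 1 - i, - m - 1 - j, - n - 1 - k)) = 0"
  proof (rule ccontr)
    assume "\<not> ?thesis"
    then have "j = - m - 1" "i \<ge> 0" "j + i = - k - 1"
      by (auto simp: delta_10_2_def iterate_uv_def binomial_coeff_def split: if_splits)
    then have "(i, j, k) = (\<lambda>k. (int k, - m - 1, m - int k)) (nat i)" by auto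
    with x show False by blast
  qed
next
  have *: "(-1) ^ i * (of_int (int i - m - 1) gchoose i) = (of_int m gchoose i :: complex)" for i
    unfolding gbinomial_negated_upper[of "of_int m" i] by simp
  show "Sum_any (\<lambda>y. case (int y, - m - 1, m - int y) of (i, j, k) \<Rightarrow> scale (delta_10_2 (i, j, k))
          (iterate_uv YV Y u v w (- l - 1 - i, - m - 1 - j, - n - 1 - k))) =
      Sum_any (\<lambda>i. scale (of_int m gchoose i) (Y (YV u (l + int i) v) (m + n - int i) w))"
  proof (rule Sum_any.cong)
    fix i :: nat
    show "(case (int i, - m - 1, m - int i) of (i, j, k) \<Rightarrow> scale (delta_10_2 (i, j, k))
          (iterate_uv YV Y u v w (- l - 1 - i, - m - 1 - j, - n - 1 - k))) =
        scale (of_int m gchoose i) (Y (YV u (l + int i) v) (m + n - int i) w)"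
      using *[of i] by (simp add: delta_10_2_def iterate_uv_def binomial_coeff_def, simp add: algebra_simps)
  qed
qed

text \<open>The exponents are \<open>l = - a - 1\<close>, \<open>m = - b - 1\<close>, \<open>n = - c - 1\<close> at \<open>x\<^sub>0\<^sup>a x\<^sub>1\<^sup>b x\<^sub>2\<^sup>c\<close>.\<close>
lemma jacobi_identity_iff_borcherds:
  "jacobi_identity YV scale Y u v w \<longleftrightarrow> (\<forall>l m n.
     Sum_any (\<lambda>i. scale ((-1) ^ i * (of_int l gchoose i)) (Y u (l + m - int i) (Y v (n + int i) w)))
     - Sum_any (\<lambda>i. scale ((-1) powi l * ((-1) ^ i * (of_int l gchoose i)))
         (Y v (l + n - int i) (Y u (m + int i) w)))
     = Sum_any (\<lambda>i. scale (of_int m gchoose i) (Y (YV u (l + int i) v) (m + n - int i) w)))"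
  (is "_ \<longleftrightarrow> (\<forall>l m n. ?B l m n)")
proof
  assume "jacobi_identity YV scale Y u v w"
  then have "series_mult scale delta_12_0 (prod_uv Y u v w) x
       - series_mult scale delta_21_0 (prod_vu Y u v w) x
     = series_mult scale delta_10_2 (iterate_uv YV Y u v w) x" for x
    unfolding jacobi_identity_def by (metis fun_diff_def)
  from this[of "(- l - 1, - m - 1, - n - 1)" for l m n]
  show "\<forall>l m n. ?B l m n"
    unfolding series_mult_delta_12_0 series_mult_delta_21_0 series_mult_delta_10_2 by blast
next
  assume "\<forall>l m n. ?B l m n"
  then have *: "series_mult scale delta_12_0 (prod_uv Y u v w) (- l - 1, - m - 1, - n - 1)
       - series_mult scale delta_21_0 (prod_vu Y u v w) (- l - 1, - m - 1, - n - 1)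
     = series_mult scale delta_10_2 (iterate_uv YV Y u v w) (- l - 1, - m - 1, - n - 1)" for l m n
    unfolding series_mult_delta_12_0 series_mult_delta_21_0 series_mult_delta_10_2 by blast
  have "series_mult scale delta_12_0 (prod_uv Y u v w) (a, b, c)
       - series_mult scale delta_21_0 (prod_vu Y u v w) (a, b, c)
     = series_mult scale delta_10_2 (iterate_uv YV Y u v w) (a, b, c)" for a b c
    using *[of "- a - 1" "- b - 1" "- c - 1"] by simp
  then show "jacobi_identity YV scale Y u v w"
    unfolding jacobi_identity_def by (auto simp: fun_eq_iff fun_diff_def)
qed

end

section \<open>Borcherds identities with finite sums in a weak module\<close>

context weak_module
begin

lemma zero_mem [simp]: "0 \<in> W"
  using subspace_W by (rule subspace_0)

lemma mode_0 [simp]: "Y v n 0 = 0"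
  using mode_scale[of 0 v n 0] by simp

lemma Y_0 [simp]: "w \<in> W \<Longrightarrow> Y 0 n w = 0"
  using Y_add[of w 0 0 n] by simp

lemma mode_sum: "(\<And>i. i \<in> A \<Longrightarrow> f i \<in> W) \<Longrightarrow> Y v n (sum f A) = (\<Sum>i\<in>A. Y v n (f i))"
proof (induction A rule: infinite_finite_induct)
  case (insert x A)
  then show ?case using subspace_sum[OF subspace_W, of A f] by (simp add: mode_add)
qed auto

lemma Y_sum: "w \<in> W \<Longrightarrow> Y (sum f A) n w = (\<Sum>i\<in>A. Y (f i) n w)"
  by (induction A rule: infinite_finite_induct) (auto simp: Y_add)

text \<open>Truncation is phrased with a filter so that finitely many bounds can be merged into one
  without naming their maximum.\<close>

lemma eventually_mode_eq_0:
  assumes "w \<in> W"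
  shows "\<forall>\<^sub>F K in sequentially. \<forall>i\<ge>K. Y v (n + int i) w = 0"
proof -
  obtain N where N: "\<forall>k\<ge>N. Y v k w = 0" using truncation[OF assms] by blast
  have "\<forall>i\<ge>K. Y v (n + int i) w = 0" if "nat (N - n) \<le> K" for K
    using that by (auto intro!: N[rule_format])
  then show ?thesis unfolding eventually_sequentially by blast
qed

text \<open>One bound \<open>K\<close> cuts off all three sums: the first by truncation of
  \<open>v\<close> on \<open>w\<close>, the second by that of \<open>u\<close> on \<open>w\<close>,
  the third by that of \<open>u\<close> on \<open>v\<close>.\<close>

lemma borcherds:
  assumes "w \<in> W" and "\<And>u v. \<exists>N. \<forall>n\<ge>N. YV u n v = 0"
  shows "\<forall>\<^sub>F K in sequentially.
     (\<Sum>i<K. scaleW ((-1) ^ i * (of_int l gchoose i)) (Y u (l + m - int i) (Y v (n + int i) w)))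
     - (\<Sum>i<K. scaleW ((-1) powi l * ((-1) ^ i * (of_int l gchoose i)))
         (Y v (l + n - int i) (Y u (m + int i) w)))
     = (\<Sum>i<K. scaleW (of_int m gchoose i) (Y (YV u (l + int i) v) (m + n - int i) w))"
proof -
  obtain N where N: "\<forall>k\<ge>N. YV u k v = 0" using assms(2) by blast
  have "\<forall>\<^sub>F K in sequentially. \<forall>i\<ge>K. YV u (l + int i) v = 0"
    unfolding eventually_sequentially by (rule exI[of _ "nat (N - l)"]) (auto intro!: N[rule_format])
  then show ?thesis
    using eventually_mode_eq_0[OF assms(1), of v n] eventually_mode_eq_0[OF assms(1), of u m]
  proof eventually_elim
    case (elim K)
    have "Sum_any (\<lambda>i. scaleW ((-1) ^ i * (of_int l gchoose i))
          (Y u (l + m - int i) (Y v (n + int i) w))) =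
        (\<Sum>i<K. scaleW ((-1) ^ i * (of_int l gchoose i)) (Y u (l + m - int i) (Y v (n + int i) w)))"
      "Sum_any (\<lambda>i. scaleW ((-1) powi l * ((-1) ^ i * (of_int l gchoose i)))
          (Y v (l + n - int i) (Y u (m + int i) w))) =
        (\<Sum>i<K. scaleW ((-1) powi l * ((-1) ^ i * (of_int l gchoose i)))
          (Y v (l + n - int i) (Y u (m + int i) w)))"
      "Sum_any (\<lambda>i. scaleW (of_int m gchoose i) (Y (YV u (l + int i) v) (m + n - int i) w)) =
        (\<Sum>i<K. scaleW (of_int m gchoose i) (Y (YV u (l + int i) v) (m + n - int i) w))"
      by (rule Sum_any_eq_sum_lessThan, use elim assms(1) in simp)+
    with jacobi[OF assms(1), of u v] show ?case
      unfolding jacobi_identity_iff_borcherds[OF vector_space_axioms] by metis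
  qed
qed

text \<open>The case \<open>l = 0\<close>: \<open>binom(0, i)\<close> leaves only the term
  \<open>i = 0\<close> of each product sum, and \<open>K > 0\<close> ensures that this term is in
  the range.\<close>

lemma commutator_formula:
  assumes "w \<in> W" and "\<And>u v. \<exists>N. \<forall>n\<ge>N. YV u n v = 0"
  shows "\<forall>\<^sub>F K in sequentially. Y u m (Y v n w) - Y v n (Y u m w) =
    (\<Sum>i<K. scaleW (of_int m gchoose i) (Y (YV u (int i) v) (m + n - int i) w))"
  using borcherds[OF assms, of 0 u m v n] eventually_gt_at_top[of 0]
proof eventually_elim
  case (elim K)
  have "(\<Sum>i<K. scaleW ((-1) ^ i * (of_int 0 gchoose i)) (f i)) = f 0" for f
    using elim(2) by (subst sum_lessThan_eq_sum[of 1]) (auto simp: gbinomial_0_left)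
  then show ?case using elim(1) by simp
qed

end

section \<open>Divided powers of \<open>L(1)\<close> and the opposite coefficients\<close>

context vertex_operator_algebra
begin

section \<open>The algebra as a module over itself; commutators of \<open>L(0)\<close> and
  \<open>L(1)\<close> with modes\<close>

sublocale adjoint: weak_module scale Y vac scale UNIV Y
proof
  fix v v' w w' u n a
  show "Y v n (w + w') = Y v n w + Y v n w'" "Y v n (scale a w) = scale a (Y v n w)"
    using module_hom.add[OF Vector_Spaces.linear.axioms(3)[OF linear_mode]]
      module_hom.scale[OF Vector_Spaces.linear.axioms(3)[OF linear_mode]] by simp_all
  show "Y (v + v') n w = Y v n w + Y v' n w" "Y (scale a v) n w = scale a (Y v n w)"
    using module_hom.add[OF Vector_Spaces.linear.axioms(3)[OF linear_Y]]
      module_hom.scale[OF Vector_Spaces.linear.axioms(3)[OF linear_Y]] by simp_all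
qed (use truncation vacuum jacobi in auto)

abbreviation "wt \<equiv> weight_space scale Y \<omega>"

lemma mem_wt_iff: "v \<in> wt n \<longleftrightarrow> Y \<omega> 1 v = scale (of_int n) v"
  by (simp add: weight_space_def virasoro_def)

lemma subspace_wt: "subspace (wt n)"
  by (auto simp: subspace_def mem_wt_iff adjoint.mode_add adjoint.mode_scale scale_right_distrib
      scale_left_commute)

text \<open>For a nonnegative mode index \<open>M\<close> the binomials vanish beyond
  \<open>M\<close>, so the bound of the sum no longer depends on the vectors.\<close>

lemma omega_commutator:
  "Y \<omega> (int M) (Y u n v) - Y u n (Y \<omega> (int M) v) =
    (\<Sum>i\<le>M. scale (of_nat (M choose i)) (Y (Y \<omega> (int i) u) (int M + n - int i) v))"
proof -
  have "\<forall>\<^sub>F K in sequentially. K > M \<and>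
    Y \<omega> (int M) (Y u n v) - Y u n (Y \<omega> (int M) v) =
    (\<Sum>i<K. scale (of_int (int M) gchoose i) (Y (Y \<omega> (int i) u) (int M + n - int i) v))"
    using adjoint.commutator_formula[of v \<omega> "int M" u n] truncation eventually_gt_at_top[of M]
    by (simp add: eventually_conj_iff)
  then obtain K where "K > M" and
    "Y \<omega> (int M) (Y u n v) - Y u n (Y \<omega> (int M) v) =
    (\<Sum>i<K. scale (of_int (int M) gchoose i) (Y (Y \<omega> (int i) u) (int M + n - int i) v))"
    using eventually_happens'[OF sequentially_bot] by blast
  then show ?thesis
    using sum_lessThan_eq_sum[of "Suc M" K
      "\<lambda>i. scale (of_int (int M) gchoose i) (Y (Y \<omega> (int i) u) (int M + n - int i) v)"]
    by (simp add: lessThan_Suc_atMost binomial_gbinomial[symmetric])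
qed

lemma omega_0_eq: "Y \<omega> 0 u = virasoro Y \<omega> (- 1) u"
  by (simp add: virasoro_def)

text \<open>Two terms contribute: \<open>L(-1) u\<close> at mode \<open>n + 1\<close> gives
  \<open>- (n + 1)\<close> by translation, and \<open>L(0) u\<close> gives \<open>a\<close>.\<close>

lemma L0_commutator:
  assumes "u \<in> wt a"
  shows "Y \<omega> 1 (Y u n v) - Y u n (Y \<omega> 1 v) = scale (of_int (a - n - 1)) (Y u n v)"
  using omega_commutator[of 1 u n v] translation[of u "n + 1" v] assms
  by (simp add: mem_wt_iff atMost_Suc omega_0_eq adjoint.Y_scale add.commute
      flip: scale_left_distrib)

text \<open>Here \<open>L(1)\<close> is the mode \<open>2\<close> of \<open>\<omega>\<close>. The
  terms \<open>i = 0\<close> and \<open>i = 1\<close> give \<open>- (n + 2)\<close> and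
  \<open>2 a\<close> times the mode \<open>n + 1\<close> of \<open>u\<close>, and
  \<open>i = 2\<close> gives the modes of \<open>L(1) u\<close>.\<close>

lemma L1_commutator:
  assumes "u \<in> wt a"
  shows "Y \<omega> 2 (Y u n v) =
    Y u n (Y \<omega> 2 v) + scale (of_int (2 * a - n - 2)) (Y u (n + 1) v) + Y (Y \<omega> 2 u) n v"
proof -
  have "Y \<omega> 2 (Y u n v) - Y u n (Y \<omega> 2 v) =
      scale (- of_int (n + 2)) (Y u (n + 1) v) + scale 2 (scale (of_int a) (Y u (n + 1) v))
      + Y (Y \<omega> 2 u) n v"
    using omega_commutator[of 2 u n v] translation[of u "n + 2" v] assms
    by (simp add: mem_wt_iff numeral_2_eq_2 atMost_Suc omega_0_eq adjoint.Y_scale add.commute)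
  then show ?thesis
    by (simp add: algebra_simps)
qed

lemma mode_mem_wt:
  assumes "u \<in> wt a" "v \<in> wt b"
  shows "Y u n v \<in> wt (a + b - n - 1)"
  using L0_commutator[OF assms(1), of n v] assms(2)
  by (simp add: mem_wt_iff adjoint.mode_scale algebra_simps)

lemma L1_mem_wt:
  assumes "v \<in> wt a"
  shows "Y \<omega> 2 v \<in> wt (a - 1)"
  using virasoro_relations[of 0 1 v] assms
  by (simp add: mem_wt_iff virasoro_def adjoint.mode_scale algebra_simps)

text \<open>The coefficient of \<open>x^j\<close> in \<open>e^(x L(1)) v\<close>. With the factorial
  absorbed, the Leibniz rule carries a single binomial coefficient.\<close>

definition L1_divpow :: "nat \<Rightarrow> 'v \<Rightarrow> 'v" where
  "L1_divpow j v = scale (1 / fact j) ((Y \<omega> 2 ^^ j) v)"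

lemma L1_divpow_0 [simp]: "L1_divpow 0 v = v"
  by (simp add: L1_divpow_def)

lemma L1_L1_divpow: "Y \<omega> 2 (L1_divpow j v) = scale (of_nat (Suc j)) (L1_divpow (Suc j) v)"
  by (simp add: L1_divpow_def adjoint.mode_scale del: of_nat_Suc)

lemma L1_divpow_mem_wt:
  assumes "v \<in> wt a"
  shows "L1_divpow j v \<in> wt (a - int j)"
proof (induction j)
  case (Suc j)
  have "L1_divpow (Suc j) v = scale (1 / of_nat (Suc j)) (Y \<omega> 2 (L1_divpow j v))"
    unfolding L1_L1_divpow scale_scale by (simp del: of_nat_Suc)
  moreover have "Y \<omega> 2 (L1_divpow j v) \<in> wt (a - int (Suc j))"
    using L1_mem_wt[OF Suc.IH] by (simp add: algebra_simps)
  ultimately show ?case using subspace_scale[OF subspace_wt] by simp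
qed (use assms in simp)

text \<open>Each \<open>L(1)\<close> lowers the weight by one, and the weights are bounded below.
  The bound \<open>N\<close> is uniform in \<open>v\<close> and \<open>a\<close>, which later serves
  all the vectors \<open>YV u (l + int i) v\<close> at once.\<close>

lemma L1_divpow_eq_0:
  obtains N where "\<And>v a j. v \<in> wt a \<Longrightarrow> nat (a - N) < j \<Longrightarrow> L1_divpow j v = 0"
proof -
  obtain N where N: "\<forall>n<N. wt n = {0}" using bounded_below by blast
  have "L1_divpow j v = 0" if "v \<in> wt a" "nat (a - N) < j" for v a j
    using L1_divpow_mem_wt[OF that(1), of j] N[rule_format, of "a - int j"] that(2) by auto
  then show ?thesis using that by blast
qed

lemma L1_divpow_eventually_0:
  assumes "v \<in> wt a"
  obtains J where "\<And>j. j \<ge> J \<Longrightarrow> L1_divpow j v = 0"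
proof -
  obtain N where N: "\<And>v a j. v \<in> wt a \<Longrightarrow> nat (a - N) < j \<Longrightarrow> L1_divpow j v = 0"
    using L1_divpow_eq_0 by blast
  show ?thesis
    by (rule that[of "Suc (nat (a - N))"]) (rule N[OF assms], simp)
qed

text \<open>The coefficient form of conjugating \<open>Y(u, z)\<close> by \<open>e^(x L(1))\<close>.
  Of the \<open>j\<close> applications of \<open>L(1)\<close>, \<open>s\<close> hit
  \<open>u\<close>, \<open>r\<close> hit \<open>v\<close>, and \<open>t\<close> raise the mode
  index. The induction applies \<open>L(1)\<close> once more and regroups by the new triple.\<close>

lemma L1_divpow_mode:
  assumes "u \<in> wt a"
  shows "L1_divpow j (Y u n v) = (\<Sum>(s, t, r) | s + t + r = j.
    scale (of_int (2 * a - int s - n - 2) gchoose t) (Y (L1_divpow s u) (n + int t) (L1_divpow r v)))"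
proof (induction j)
  case 0
  have "{(s, t, r). s + t + r = (0::nat)} = {(0, 0, 0)}" by auto
  then show ?case by simp
next
  case (Suc j)
  define T :: "nat \<Rightarrow> (nat \<times> nat \<times> nat) set" where "T k = {(s, t, r). s + t + r = k}" for k
  have fin: "finite (T k)" for k
    by (rule finite_subset[of _ "{..k} \<times> {..k} \<times> {..k}"]) (auto simp: T_def)
  define N where "N s = (of_int (2 * a - int s - n - 2) :: complex)" for s
  define X where "X s t r = Y (L1_divpow s u) (n + int t) (L1_divpow r v)" for s t r
  \<comment> \<open>Shifting \<open>s\<close> in the reindexing below changes the upper entry of the
    binomial by one; \<open>s > 0\<close> excludes truncated subtraction.\<close>
  have N_Suc: "N s + 1 = N (s - 1)" if "s > 0" for s
    using that by (simp add: N_def of_nat_diff)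
  \<comment> \<open>The vector \<open>L1_divpow s u\<close> has weight \<open>a - s\<close> and
    stands at mode \<open>n + t\<close>, so the middle factor is
    \<open>2 (a - s) - (n + t) - 2 = N s - s - t\<close>.\<close>
  have L1_X: "Y \<omega> 2 (X s t r) = scale (of_nat (Suc r)) (X s t (Suc r))
      + scale (N s - of_nat s - of_nat t) (X s (Suc t) r)
      + scale (of_nat (Suc s)) (X (Suc s) t r)" for s t r
    unfolding X_def
    by (subst L1_commutator[OF L1_divpow_mem_wt[OF assms]])
      (simp add: L1_L1_divpow adjoint.mode_scale adjoint.Y_scale adjoint.mode_add adjoint.Y_add
        N_def algebra_simps)
  \<comment> \<open>Pascal's rule splits off \<open>s\<close> times two binomials, and the rest is
    the absorption identity \<open>(k + 1) binom(N, k + 1) = (N - k) binom(N, k)\<close> with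
    \<open>t = k + 1\<close>.\<close>
  have coeff: "of_nat (s + t) * (N s gchoose t) = of_nat s * (N s + 1 gchoose t)
      + (if t = 0 then 0 else (N s - of_nat s - of_nat (t - 1)) * (N s gchoose (t - 1)))" for s t
  proof (cases t)
    case (Suc k)
    show ?thesis
      using gbinomial_mult_1[of "N s" k] gbinomial_Suc_Suc[of "N s" k]
      by (simp add: Suc algebra_simps)
  qed simp
  have "scale (of_nat (Suc j)) (L1_divpow (Suc j) (Y u n v)) = Y \<omega> 2 (L1_divpow j (Y u n v))"
    by (simp only: L1_L1_divpow)
  also have "\<dots> = (\<Sum>(s, t, r)\<in>T j. scale (N s gchoose t) (Y \<omega> 2 (X s t r)))"
    unfolding Suc.IH
    by (simp add: adjoint.mode_sum adjoint.mode_scale N_def X_def T_def split_def)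
  also have "\<dots> = (\<Sum>(s, t, r)\<in>T j. scale (of_nat (Suc r) * (N s gchoose t)) (X s t (Suc r)))
      + (\<Sum>(s, t, r)\<in>T j. scale ((N s - of_nat s - of_nat t) * (N s gchoose t)) (X s (Suc t) r))
      + (\<Sum>(s, t, r)\<in>T j. scale (of_nat (Suc s) * (N s gchoose t)) (X (Suc s) t r))"
    unfolding L1_X by (simp add: scale_right_distrib sum.distrib split_def mult.commute)
  \<comment> \<open>Each of the three sums is moved to level \<open>Suc j\<close> by raising one
    index. The triples not reached have that index equal to \<open>0\<close>, where the new
    coefficient vanishes.\<close>
  also have "(\<Sum>(s, t, r)\<in>T j. scale (of_nat (Suc r) * (N s gchoose t)) (X s t (Suc r)))
      = (\<Sum>(s, t, r)\<in>T (Suc j). scale (of_nat r * (N s gchoose t)) (X s t r))"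
    by (rule sum.reindex_bij_witness_not_neutral[where
          S' = "{}" and T' = "{x \<in> T (Suc j). snd (snd x) = 0}" and
          i = "\<lambda>(s, t, r). (s, t, r - 1)" and j = "\<lambda>(s, t, r). (s, t, Suc r)"])
      (auto simp: T_def fin[unfolded T_def])
  also have "(\<Sum>(s, t, r)\<in>T j. scale ((N s - of_nat s - of_nat t) * (N s gchoose t)) (X s (Suc t) r))
      = (\<Sum>(s, t, r)\<in>T (Suc j). scale (if t = 0 then 0
          else (N s - of_nat s - of_nat (t - 1)) * (N s gchoose (t - 1))) (X s t r))"
    by (rule sum.reindex_bij_witness_not_neutral[where
          S' = "{}" and T' = "{x \<in> T (Suc j). fst (snd x) = 0}" and
          i = "\<lambda>(s, t, r). (s, t - 1, r)" and j = "\<lambda>(s, t, r). (s, Suc t, r)"])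
      (auto simp: T_def fin[unfolded T_def])
  also have "(\<Sum>(s, t, r)\<in>T j. scale (of_nat (Suc s) * (N s gchoose t)) (X (Suc s) t r))
      = (\<Sum>(s, t, r)\<in>T (Suc j). scale (of_nat s * (N s + 1 gchoose t)) (X s t r))"
    by (rule sum.reindex_bij_witness_not_neutral[where
          S' = "{}" and T' = "{x \<in> T (Suc j). fst x = 0}" and
          i = "\<lambda>(s, t, r). (s - 1, t, r)" and j = "\<lambda>(s, t, r). (Suc s, t, r)"])
      (auto simp: T_def fin[unfolded T_def] N_Suc)
  also have "(\<Sum>(s, t, r)\<in>T (Suc j). scale (of_nat r * (N s gchoose t)) (X s t r))
      + (\<Sum>(s, t, r)\<in>T (Suc j). scale (if t = 0 then 0
          else (N s - of_nat s - of_nat (t - 1)) * (N s gchoose (t - 1))) (X s t r))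
      + (\<Sum>(s, t, r)\<in>T (Suc j). scale (of_nat s * (N s + 1 gchoose t)) (X s t r))
      = (\<Sum>(s, t, r)\<in>T (Suc j). scale (of_nat (s + t + r) * (N s gchoose t)) (X s t r))"
  proof -
    have "of_nat (s + t + r) * (N s gchoose t) = of_nat r * (N s gchoose t)
      + (if t = 0 then 0 else (N s - of_nat s - of_nat (t - 1)) * (N s gchoose (t - 1)))
      + of_nat s * (N s + 1 gchoose t)" for s t r
      using coeff[of s t] by (simp add: algebra_simps)
    then show ?thesis
      by (simp only: scale_left_distrib sum.distrib split_def)
  qed
  \<comment> \<open>The factor \<open>s + t + r\<close> is constant on the level set and cancels
    against the left side.\<close>
  also have "\<dots> = (\<Sum>(s, t, r)\<in>T (Suc j). scale (of_nat (Suc j)) (scale (N s gchoose t) (X s t r)))"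
    by (rule sum.cong) (auto simp: T_def simp del: of_nat_Suc of_nat_add)
  also have "\<dots> = scale (of_nat (Suc j)) (\<Sum>(s, t, r)\<in>T (Suc j). scale (N s gchoose t) (X s t r))"
    by (simp only: scale_sum_right split_def)
  finally have "L1_divpow (Suc j) (Y u n v) = (\<Sum>(s, t, r)\<in>T (Suc j). scale (N s gchoose t) (X s t r))"
    by (simp add: scale_cancel_left del: of_nat_Suc)
  then show ?case by (simp only: T_def N_def X_def)
qed

section \<open>Weight components and reduction to homogeneous vectors\<close>

lemma homogeneous_induct:
  assumes "\<And>a v. v \<in> wt a \<Longrightarrow> P v" and "\<And>u v. P u \<Longrightarrow> P v \<Longrightarrow> P (u + v)"
  shows "P v"
proof -
  obtain f where f: "weight_decomposition scale Y \<omega> v f" using direct_sum by blast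
  have "P (sum f A)" if "finite A" for A
    using that
  proof (induction A rule: finite_induct)
    case empty
    show ?case using assms(1)[of 0 0] subspace_0[OF subspace_wt] by simp
  next
    case (insert x A)
    then have "P (f x + sum f A)"
      using f by (intro assms(2)[OF assms(1)[of "f x" x] insert.IH]) (auto simp: weight_decomposition_def)
    then show ?case using insert.hyps by simp
  qed
  then show ?thesis using f by (auto simp: weight_decomposition_def Sum_any.expand_set)
qed

abbreviation "wcomp \<equiv> weight_component scale Y \<omega>"

lemma weight_component_eqI: "weight_decomposition scale Y \<omega> v f \<Longrightarrow> wcomp n v = f n"
  unfolding weight_component_def using the1_equality[OF direct_sum] by metis

lemma weight_decomposition_wcomp: "weight_decomposition scale Y \<omega> v (\<lambda>n. wcomp n v)"
proof -
  obtain f where f: "weight_decomposition scale Y \<omega> v f" using direct_sum by blast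
  moreover have "f = (\<lambda>n. wcomp n v)" using weight_component_eqI[OF f] by auto
  ultimately show ?thesis by simp
qed

lemma finite_wcomp: "finite {n. wcomp n v \<noteq> 0}"
  using weight_decomposition_wcomp unfolding weight_decomposition_def by blast

lemma wcomp_add: "wcomp n (u + v) = wcomp n u + wcomp n v"
proof (rule weight_component_eqI)
  have "{n. wcomp n u + wcomp n v \<noteq> 0} \<subseteq> {n. wcomp n u \<noteq> 0} \<union> {n. wcomp n v \<noteq> 0}" by auto
  then show "weight_decomposition scale Y \<omega> (u + v) (\<lambda>n. wcomp n u + wcomp n v)"
    using weight_decomposition_wcomp[of u] weight_decomposition_wcomp[of v]
    unfolding weight_decomposition_def
    by (auto simp: Sum_any.distrib intro: subspace_add[OF subspace_wt] finite_subset)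
qed

lemma wcomp_homogeneous:
  assumes "v \<in> wt a"
  shows "wcomp n v = (if n = a then v else 0)"
proof (rule weight_component_eqI)
  show "weight_decomposition scale Y \<omega> v (\<lambda>n. if n = a then v else 0)"
    using assms subspace_0[OF subspace_wt] by (auto simp: weight_decomposition_def)
qed

section \<open>Coefficients of the argument of the opposite vertex operator\<close>

abbreviation "L0_coeff \<equiv> L0_power_coeff scale Y \<omega>"

lemma L0_coeff_add: "L0_coeff (u + v) q = L0_coeff u q + L0_coeff v q"
  by (simp add: L0_power_coeff_def wcomp_add scale_right_distrib)

text \<open>A nonzero term requires \<open>p - j = - 2 k\<close> for one of the finitely many
  weights \<open>k\<close> occurring in \<open>v\<close>, that is,
  \<open>j = p + 2 k\<close>.\<close>

lemma finite_L0_coeff: "finite {j. L0_coeff v (p - int j) \<noteq> 0}"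
proof (rule finite_subset)
  show "{j. L0_coeff v (p - int j) \<noteq> 0} \<subseteq> (\<lambda>k. nat (p + 2 * k)) ` {k. wcomp k v \<noteq> 0}"
  proof
    fix j assume "j \<in> {j. L0_coeff v (p - int j) \<noteq> 0}"
    then have "even (p - int j)" "wcomp (- ((p - int j) div 2)) v \<noteq> 0"
      by (auto simp: L0_power_coeff_def split: if_splits)
    then show "j \<in> (\<lambda>k. nat (p + 2 * k)) ` {k. wcomp k v \<noteq> 0}"
      by (intro image_eqI[of _ _ "- ((p - int j) div 2)"]) auto
  qed
qed (simp add: finite_wcomp)

lemma L0_coeff_homogeneous:
  assumes "v \<in> wt a"
  shows "L0_coeff v q = (if q = - 2 * a then scale ((-1) powi a) v else 0)"
  by (auto simp: L0_power_coeff_def wcomp_homogeneous[OF assms])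

lemma omega_funpow_0 [simp]: "(Y \<omega> n ^^ j) 0 = 0"
  by (induction j) auto

lemma omega_funpow_add: "(Y \<omega> n ^^ j) (u + v) = (Y \<omega> n ^^ j) u + (Y \<omega> n ^^ j) v"
  by (induction j) (auto simp: adjoint.mode_add)

lemma omega_funpow_scale: "(Y \<omega> n ^^ j) (scale x v) = scale x ((Y \<omega> n ^^ j) v)"
  by (induction j) (auto simp: adjoint.mode_scale)

lemma L1_divpow_scale: "L1_divpow j (scale x v) = scale x (L1_divpow j v)"
  by (simp add: L1_divpow_def omega_funpow_scale scale_left_commute)

abbreviation "opp_coeff \<equiv> opposite_coeff scale Y \<omega>"

lemma opp_coeff_eq: "opp_coeff v p = Sum_any (\<lambda>j. L1_divpow j (L0_coeff v (p - int j)))"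
  by (simp add: opposite_coeff_def L1_divpow_def virasoro_def)

lemma opp_coeff_add: "opp_coeff (u + v) p = opp_coeff u p + opp_coeff v p"
proof -
  have "finite {j. L1_divpow j (L0_coeff v (p - int j)) \<noteq> 0}" for v
    by (rule finite_subset[OF _ finite_L0_coeff[of v p]]) (auto simp: L1_divpow_def)
  then show ?thesis
    unfolding opp_coeff_eq
    by (simp add: L0_coeff_add L1_divpow_def omega_funpow_add scale_right_distrib Sum_any.distrib)
qed

text \<open>Only the exponent \<open>- 2 a\<close> occurs in the \<open>L(0)\<close> factor, so the
  exponential has to supply \<open>j = p + 2 a\<close>.\<close>

lemma opp_coeff_homogeneous:
  assumes "v \<in> wt a"
  shows "opp_coeff v p =
    (if p + 2 * a \<ge> 0 then scale ((-1) powi a) (L1_divpow (nat (p + 2 * a)) v) else 0)"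
proof -
  have *: "L1_divpow j (L0_coeff v (p - int j)) =
    (if p + 2 * a = int j then scale ((-1) powi a) (L1_divpow j v) else 0)" for j
    by (auto simp: L0_coeff_homogeneous[OF assms] L1_divpow_scale)
      (simp add: L1_divpow_def)
  define k where "k = nat (p + 2 * a)"
  have "opp_coeff v p = (\<Sum>j\<in>{k}. L1_divpow j (L0_coeff v (p - int j)))"
    unfolding opp_coeff_eq by (rule Sum_any.expand_superset) (auto simp: * k_def)
  also have "\<dots> = (if p + 2 * a = int k then scale ((-1) powi a) (L1_divpow k v) else 0)"
    using *[of k] by simp
  finally show ?thesis by (simp add: k_def)
qed

text \<open>This makes the sum defining \<open>opp\<close> finite with a support independent of
  \<open>w\<close>; \<open>Sum_any\<close> then respects addition.\<close>

lemma finite_opp_coeff: "finite {p. opp_coeff v p \<noteq> 0}"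
proof (induction v rule: homogeneous_induct)
  case (1 a v)
  obtain N where N: "\<And>v a j. v \<in> wt a \<Longrightarrow> nat (a - N) < j \<Longrightarrow> L1_divpow j v = 0"
    using L1_divpow_eq_0 by blast
  have "{p. opp_coeff v p \<noteq> 0} \<subseteq> {- 2 * a .. - 2 * a + int (nat (a - N))}"
  proof
    fix p assume "p \<in> {p. opp_coeff v p \<noteq> 0}"
    then have "p + 2 * a \<ge> 0" "L1_divpow (nat (p + 2 * a)) v \<noteq> 0"
      by (auto simp: opp_coeff_homogeneous[OF 1] split: if_splits)
    with N[OF 1, of "nat (p + 2 * a)"] show "p \<in> {- 2 * a .. - 2 * a + int (nat (a - N))}"
      by force
  qed
  then show ?case by (rule finite_subset) simp
next
  case (2 u v)
  show ?case
    by (rule finite_subset[OF _ finite_UnI[OF 2]]) (auto simp: opp_coeff_add)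
qed

end

section \<open>The opposite Borcherds identity\<close>

locale voa_module =
  V: vertex_operator_algebra scaleV YV vac \<omega> c + weak_module scaleV YV vac scaleW UNIV Y
  for scaleV :: "complex \<Rightarrow> 'v::ab_group_add \<Rightarrow> 'v"
    and YV :: "('v, 'v) vertex_map"
    and vac \<omega> :: 'v
    and c :: complex
    and scaleW :: "complex \<Rightarrow> 'w::ab_group_add \<Rightarrow> 'w"
    and Y :: "('v, 'w) vertex_map"
begin

text \<open>The operator whose transpose is \<open>dual v n\<close>. It acts on all of
  \<open>W\<close>, so the main identity can be proved before any functional is chosen.\<close>

definition opp :: "('v, 'w) vertex_map" where
  "opp v n w = Sum_any (\<lambda>p. Y (V.opp_coeff v p) (- n - 2 - p) w)"

lemma dual_vertex_map_eq: "dual_vertex_map scaleV YV \<omega> Y v n \<alpha> = (\<lambda>w. \<alpha> (opp v n w))"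
  by (simp add: dual_vertex_map_def opp_def)

lemma opp_homogeneous:
  assumes "v \<in> V.wt a" and "\<And>j. j \<ge> J \<Longrightarrow> V.L1_divpow j v = 0"
  shows "opp v n w = (\<Sum>j<J. scaleW ((-1) powi a) (Y (V.L1_divpow j v) (2 * a - int j - n - 2) w))"
proof -
  \<comment> \<open>The nonzero coefficients sit at \<open>p = j - 2 a\<close> with \<open>j\<close>
    a natural number, the power of \<open>L(1)\<close>.\<close>
  have "inj (\<lambda>j. int j - 2 * a)" by (auto simp: inj_on_def)
  then have "opp v n w = Sum_any (\<lambda>j. Y (V.opp_coeff v (int j - 2 * a)) (- n - 2 - (int j - 2 * a)) w)"
    unfolding opp_def
  proof (rule Sum_any_reindex_inj)
    fix p assume "p \<notin> range (\<lambda>j. int j - 2 * a)"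
    moreover have "p = int (nat (p + 2 * a)) - 2 * a" if "p + 2 * a \<ge> 0" using that by simp
    ultimately have "\<not> p + 2 * a \<ge> 0" by blast
    then show "Y (V.opp_coeff v p) (- n - 2 - p) w = 0"
      by (simp add: V.opp_coeff_homogeneous[OF assms(1)])
  qed
  also have "\<dots> = (\<Sum>j<J. Y (V.opp_coeff v (int j - 2 * a)) (- n - 2 - (int j - 2 * a)) w)"
    by (rule Sum_any_eq_sum_lessThan) (simp add: V.opp_coeff_homogeneous[OF assms(1)] assms(2))
  also have "\<dots> = (\<Sum>j<J. scaleW ((-1) powi a) (Y (V.L1_divpow j v) (2 * a - int j - n - 2) w))"
    by (rule sum.cong) (simp_all add: V.opp_coeff_homogeneous[OF assms(1)] Y_scale algebra_simps)
  finally show ?thesis .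
qed

lemma homogeneous_expansion:
  assumes "v \<in> V.wt a"
  obtains J where "\<And>n w. opp v n w =
    (\<Sum>j<J. scaleW ((-1) powi a) (Y (V.L1_divpow j v) (2 * a - int j - n - 2) w))"
proof -
  obtain J where "\<And>j. j \<ge> J \<Longrightarrow> V.L1_divpow j v = 0"
    using V.L1_divpow_eventually_0[OF assms] by blast
  then show ?thesis using that opp_homogeneous[OF assms] by blast
qed

lemma opp_add_left: "opp (u + v) n w = opp u n w + opp v n w"
proof -
  have "finite {p. Y (V.opp_coeff v p) (- n - 2 - p) w \<noteq> 0}" for v
    by (rule finite_subset[OF _ V.finite_opp_coeff[of v]]) auto
  then show ?thesis
    by (simp add: opp_def V.opp_coeff_add Y_add Sum_any.distrib)
qed

lemma opp_0_left [simp]: "opp 0 n w = 0"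
  using opp_add_left[of 0 0 n w] by simp

lemma opp_scale_left: "opp (scaleV x v) n w = scaleW x (opp v n w)"
proof (induction v rule: V.homogeneous_induct)
  case (1 a v)
  obtain J where J: "\<And>j. j \<ge> J \<Longrightarrow> V.L1_divpow j v = 0"
    using V.L1_divpow_eventually_0[OF 1] by blast
  have "scaleV x v \<in> V.wt a" using 1 V.subspace_scale[OF V.subspace_wt] by blast
  moreover have "\<And>j. j \<ge> J \<Longrightarrow> V.L1_divpow j (scaleV x v) = 0"
    by (simp add: V.L1_divpow_scale J)
  ultimately show ?case
    by (simp add: opp_homogeneous[OF 1 J] opp_homogeneous[where J = J and a = a]
        V.L1_divpow_scale Y_scale scale_sum_right mult.commute)
next
  case (2 u v)
  then show ?case by (simp add: opp_add_left V.scale_right_distrib scale_right_distrib)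
qed

lemma opp_add_right: "opp v n (w + w') = opp v n w + opp v n w'"
proof (induction v rule: V.homogeneous_induct)
  case (1 a v)
  then obtain J where "\<And>n w. opp v n w =
    (\<Sum>j<J. scaleW ((-1) powi a) (Y (V.L1_divpow j v) (2 * a - int j - n - 2) w))"
    using homogeneous_expansion by blast
  then show ?case by (simp add: mode_add scale_right_distrib sum.distrib)
qed (simp add: opp_add_left algebra_simps)

lemma opp_scale_right: "opp v n (scaleW x w) = scaleW x (opp v n w)"
proof (induction v rule: V.homogeneous_induct)
  case (1 a v)
  then obtain J where "\<And>n w. opp v n w =
    (\<Sum>j<J. scaleW ((-1) powi a) (Y (V.L1_divpow j v) (2 * a - int j - n - 2) w))"
    using homogeneous_expansion by blast
  then show ?case by (simp add: mode_scale scale_sum_right mult.commute)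
qed (simp add: opp_add_left scale_right_distrib)

text \<open>\<open>L(1)\<close> kills the vacuum, which has weight \<open>0\<close>. Hence
  \<open>opp vac n\<close> is the vacuum mode \<open>- n - 2\<close>, the identity exactly for
  \<open>n = - 1\<close>.\<close>

lemma opp_vacuum: "opp vac n w = (if n = - 1 then w else 0)"
proof -
  have "V.L1_divpow (Suc j) vac = 0" for j
    by (simp add: V.L1_divpow_def funpow_Suc_right V.creation(1) del: funpow.simps)
  then have "V.L1_divpow j vac = 0" if "j \<ge> 1" for j
    using that by (cases j) auto
  moreover have "vac \<in> V.wt 0" by (simp add: V.mem_wt_iff V.creation(1))
  ultimately show ?thesis
    by (simp add: opp_homogeneous[where J = 1 and a = 0] vacuum)
qed

text \<open>After the Leibniz rule the summand depends on \<open>i\<close> and \<open>t\<close> only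
  through \<open>q = i + t\<close>, apart from its coefficient. Summing
  \<open>(-1)^i binom(m, i) binom(X s - i, q - i)\<close> over \<open>i\<close> gives
  \<open>binom(X s - m, q)\<close>, the coefficient of an iterate side with new indices.\<close>

lemma borcherds_homogeneous_expansion:
  assumes "u \<in> V.wt a" "v \<in> V.wt b"
    and "\<And>s. s \<ge> S \<Longrightarrow> V.L1_divpow s u = 0" "\<And>r. r \<ge> S \<Longrightarrow> V.L1_divpow r v = 0"
    and "\<And>s q r. q \<ge> K \<Longrightarrow> YV (V.L1_divpow s u) (l + int q) (V.L1_divpow r v) = 0"
  shows "(\<Sum>i<K. scaleW (of_int m gchoose i) (opp (YV u (l + int i) v) (m + n - int i) w)) =
    (\<Sum>s<S. \<Sum>r<S. scaleW (- ((-1) powi a * (-1) powi b * (-1) powi l))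
      (\<Sum>q<K. scaleW (of_int (2 * a - int s - l - 2 - m) gchoose q)
        (Y (YV (V.L1_divpow s u) (l + int q) (V.L1_divpow r v))
          ((2 * a - int s - l - 2 - m) + (2 * b - int r - l - 2 - n) - int q) w)))"
proof -
  define H where "H s r q = Y (YV (V.L1_divpow s u) (l + int q) (V.L1_divpow r v))
    ((2 * a - int s - l - 2 - m) + (2 * b - int r - l - 2 - n) - int q) w" for s r q
  define X where "X s = (of_int (2 * a - int s - l - 2) :: complex)" for s
  \<comment> \<open>The sign \<open>(-1)\<close> to the weight \<open>a + b - (l + i) - 1\<close> of
    the iterate, with the factor \<open>(-1)^i\<close> left out.\<close>
  define e :: complex where "e = - ((-1) powi a * (-1) powi b * (-1) powi l)"
  have H_0: "H s r q = 0" if "s \<ge> S \<or> q \<ge> K \<or> r \<ge> S" for s r q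
    using that assms(3-5) by (auto simp: H_def)
  obtain N where N: "\<And>v a j. v \<in> V.wt a \<Longrightarrow> nat (a - N) < j \<Longrightarrow> V.L1_divpow j v = 0"
    using V.L1_divpow_eq_0 by blast
  \<comment> \<open>The first entry exceeds every power of \<open>L(1)\<close> that survives on some
    iterate, as the weights decrease with \<open>i\<close>; the second lets the level sets cover the
    box.\<close>
  define J where "J = max (Suc (nat (a + b - l - 1 - N))) (S + K + S)"
  have expand: "opp (YV u (l + int i) v) (m + n - int i) w =
    (\<Sum>s<S. \<Sum>r<S. \<Sum>t<K. scaleW (e * (-1) ^ i * (X s - of_nat i gchoose t)) (H s r (i + t)))" for i
  proof -
    let ?d = "a + b - (l + int i) - 1"
    have sign: "(-1) powi ?d = e * (-1) ^ i"
      by (simp add: e_def power_int_minus_left minus_one_power_iff)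
    have wt: "YV u (l + int i) v \<in> V.wt ?d"
      by (rule V.mode_mem_wt[OF assms(1,2)])
    have "opp (YV u (l + int i) v) (m + n - int i) w = (\<Sum>j<J. scaleW ((-1) powi ?d)
      (Y (V.L1_divpow j (YV u (l + int i) v)) (2 * ?d - int j - (m + n - int i) - 2) w))"
    proof (rule opp_homogeneous[OF wt], rule N[OF wt])
      fix j assume "J \<le> j"
      have "nat (?d - N) \<le> nat (a + b - l - 1 - N)"
        by (rule nat_mono) simp
      also have "\<dots> < j"
        using \<open>J \<le> j\<close> by (simp add: J_def)
      finally show "nat (?d - N) < j" .
    qed
    also have "\<dots> = (\<Sum>j<J. \<Sum>(s, t, r) | s + t + r = j.
        scaleW (e * (-1) ^ i * (X s - of_nat i gchoose t)) (H s r (i + t)))"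
    proof (rule sum.cong[OF refl])
      fix j
      have "Y (V.L1_divpow j (YV u (l + int i) v)) (2 * ?d - int j - (m + n - int i) - 2) w =
        (\<Sum>(s, t, r) | s + t + r = j. scaleW (X s - of_nat i gchoose t) (H s r (i + t)))"
        unfolding V.L1_divpow_mode[OF assms(1)] Y_sum[OF UNIV_I] split_def
      proof (rule sum.cong[OF refl])
        fix x :: "nat \<times> nat \<times> nat" assume "x \<in> {x. fst x + fst (snd x) + snd (snd x) = j}"
        then obtain s t r where x: "x = (s, t, r)" and j: "j = s + t + r"
          by (cases x) auto
        have "2 * ?d - int j - (m + n - int i) - 2 =
          (2 * a - int s - l - 2 - m) + (2 * b - int r - l - 2 - n) - int (i + t)"
          by (simp add: j)
        moreover have "of_int (2 * a - int s - (l + int i) - 2) = X s - of_nat i"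
          by (simp add: X_def)
        moreover have "l + int i + int t = l + int (i + t)"
          by simp
        ultimately show "Y (scaleV (of_int (2 * a - int (fst x) - (l + int i) - 2) gchoose fst (snd x))
            (YV (V.L1_divpow (fst x) u) (l + int i + int (fst (snd x))) (V.L1_divpow (snd (snd x)) v)))
            (2 * ?d - int j - (m + n - int i) - 2) w =
          scaleW (X (fst x) - of_nat i gchoose fst (snd x)) (H (fst x) (snd (snd x)) (i + fst (snd x)))"
          unfolding x fst_conv snd_conv H_def by (simp only: Y_scale[OF UNIV_I])
      qed
      then show "scaleW ((-1) powi ?d)
          (Y (V.L1_divpow j (YV u (l + int i) v)) (2 * ?d - int j - (m + n - int i) - 2) w) =
        (\<Sum>(s, t, r) | s + t + r = j.
          scaleW (e * (-1) ^ i * (X s - of_nat i gchoose t)) (H s r (i + t)))"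
        by (simp only: sign scale_sum_right scale_scale split_def)
    qed
    also have "\<dots> = (\<Sum>s<S. \<Sum>r<S. \<Sum>t<K.
        scaleW (e * (-1) ^ i * (X s - of_nat i gchoose t)) (H s r (i + t)))"
    proof (rule sum_level_sets)
      fix s t r assume "s \<ge> S \<or> t \<ge> K \<or> r \<ge> S"
      then have "H s r (i + t) = 0" by (intro H_0) auto
      then show "scaleW (e * (-1) ^ i * (X s - of_nat i gchoose t)) (H s r (i + t)) = 0" by simp
    qed (simp add: J_def)
    finally show ?thesis .
  qed
  have "(\<Sum>i<K. scaleW (of_int m gchoose i) (opp (YV u (l + int i) v) (m + n - int i) w)) =
    (\<Sum>i<K. \<Sum>s<S. \<Sum>r<S. \<Sum>t<K. scaleW
      (e * ((-1) ^ i * (of_int m gchoose i) * (X s - of_nat i gchoose t))) (H s r (i + t)))"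
    unfolding expand scale_sum_right scale_scale by (simp only: mult_ac)
  also have "\<dots> = (\<Sum>s<S. \<Sum>r<S. \<Sum>i<K. \<Sum>t<K. scaleW
      (e * ((-1) ^ i * (of_int m gchoose i) * (X s - of_nat i gchoose t))) (H s r (i + t)))"
    by (subst sum.swap, rule sum.cong[OF refl], rule sum.swap)
  also have "\<dots> = (\<Sum>s<S. \<Sum>r<S. scaleW e (\<Sum>q<K. scaleW (X s - of_int m gchoose q) (H s r q)))"
  proof (intro sum.cong refl)
    fix s r
    have "(\<Sum>i<K. \<Sum>t<K. scaleW
        (e * ((-1) ^ i * (of_int m gchoose i) * (X s - of_nat i gchoose t))) (H s r (i + t)))
      = (\<Sum>q<K. scaleW (\<Sum>i\<le>q. e * ((-1) ^ i * (of_int m gchoose i) * (X s - of_nat i gchoose (q - i))))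
          (H s r q))"
      by (rule sum_convolution[OF vector_space_axioms]) (simp add: H_0)
    also have "\<dots> = (\<Sum>q<K. scaleW (e * (X s - of_int m gchoose q)) (H s r q))"
      by (simp only: sum_distrib_left[symmetric] sum_gbinomial_mult_gbinomial_diff)
    finally show "(\<Sum>i<K. \<Sum>t<K. scaleW
        (e * ((-1) ^ i * (of_int m gchoose i) * (X s - of_nat i gchoose t))) (H s r (i + t)))
      = scaleW e (\<Sum>q<K. scaleW (X s - of_int m gchoose q) (H s r q))"
      by (simp only: scale_sum_right scale_scale)
  qed
  finally show ?thesis
    by (simp add: e_def X_def H_def)
qed

text \<open>A mode of \<open>v\<close> applied after one of \<open>u\<close> stays in this order
  under \<open>opp\<close>, with new indices. So the first sum here comes from the second sum of the
  ordinary identities at \<open>(l, M s, N r)\<close> and conversely, and the minus sign in the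
  expanded iterate side accounts for the exchange.\<close>

lemma opposite_borcherds_homogeneous:
  assumes u: "u \<in> V.wt a" and v: "v \<in> V.wt b"
  shows "\<forall>\<^sub>F K in sequentially.
    (\<Sum>i<K. scaleW ((-1) ^ i * (of_int l gchoose i)) (opp v (n + int i) (opp u (l + m - int i) w)))
    - (\<Sum>i<K. scaleW ((-1) powi l * ((-1) ^ i * (of_int l gchoose i)))
        (opp u (m + int i) (opp v (l + n - int i) w)))
    = (\<Sum>i<K. scaleW (of_int m gchoose i) (opp (YV u (l + int i) v) (m + n - int i) w))"
proof -
  obtain S1 where S1: "\<And>s. s \<ge> S1 \<Longrightarrow> V.L1_divpow s u = 0"
    using V.L1_divpow_eventually_0[OF u] by blast
  obtain S2 where S2: "\<And>s. s \<ge> S2 \<Longrightarrow> V.L1_divpow s v = 0"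
    using V.L1_divpow_eventually_0[OF v] by blast
  define S where "S = max S1 S2"
  have S: "V.L1_divpow s u = 0" "V.L1_divpow s v = 0" if "s \<ge> S" for s
    using that S1 S2 by (simp_all add: S_def)
  define M where "M s = 2 * a - int s - l - 2 - m" for s
  define N where "N r = 2 * b - int r - l - 2 - n" for r
  define U where "U s = Y (V.L1_divpow s u)" for s
  define V' where "V' r = Y (V.L1_divpow r v)" for r
  define \<epsilon> :: complex where "\<epsilon> = (-1) powi a * (-1) powi b"
  \<comment> \<open>Only finitely many pairs \<open>(s, r)\<close> matter, so one \<open>K\<close>
    suffices. Termwise vanishing from \<open>K\<close> on is recorded separately because the
    expansion of the iterate side uses it.\<close>
  have "\<forall>\<^sub>F K in sequentially. \<forall>s\<in>{..<S}. \<forall>r\<in>{..<S}.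
      (\<forall>q\<ge>K. YV (V.L1_divpow s u) (l + int q) (V.L1_divpow r v) = 0)"
    by (intro eventually_ball_finite ballI V.adjoint.eventually_mode_eq_0) auto
  moreover have "\<forall>\<^sub>F K in sequentially. \<forall>s\<in>{..<S}. \<forall>r\<in>{..<S}.
     (\<Sum>i<K. scaleW ((-1) ^ i * (of_int l gchoose i)) (U s (l + M s - int i) (V' r (N r + int i) w)))
     - (\<Sum>i<K. scaleW ((-1) powi l * ((-1) ^ i * (of_int l gchoose i)))
         (V' r (l + N r - int i) (U s (M s + int i) w)))
     = (\<Sum>i<K. scaleW (of_int (M s) gchoose i)
         (Y (YV (V.L1_divpow s u) (l + int i) (V.L1_divpow r v)) (M s + N r - int i) w))"
    unfolding U_def V'_def by (intro eventually_ball_finite ballI borcherds V.truncation) auto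
  ultimately show ?thesis
  proof eventually_elim
    case (elim K)
    define B1 where "B1 s r = (\<Sum>i<K. scaleW ((-1) ^ i * (of_int l gchoose i))
      (U s (l + M s - int i) (V' r (N r + int i) w)))" for s r
    define B2 where "B2 s r = (\<Sum>i<K. scaleW ((-1) powi l * ((-1) ^ i * (of_int l gchoose i)))
      (V' r (l + N r - int i) (U s (M s + int i) w)))" for s r
    have opp_u: "opp u k x = (\<Sum>s<S. scaleW ((-1) powi a) (U s (2 * a - int s - k - 2) x))" for k x
      unfolding U_def by (rule opp_homogeneous[OF u S(1)])
    have opp_v: "opp v k x = (\<Sum>r<S. scaleW ((-1) powi b) (V' r (2 * b - int r - k - 2) x))" for k x
      unfolding V'_def by (rule opp_homogeneous[OF v S(2)])
    have vu: "opp v (n + int i) (opp u (l + m - int i) w) =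
      (\<Sum>s<S. \<Sum>r<S. scaleW \<epsilon> (V' r (l + N r - int i) (U s (M s + int i) w)))" for i
    proof -
      have eq: "2 * b - int r - (n + int i) - 2 = l + N r - int i"
        "2 * a - int s - (l + m - int i) - 2 = M s + int i" for r s
        by (simp_all add: M_def N_def)
      have "opp v (n + int i) (opp u (l + m - int i) w) =
        (\<Sum>r<S. \<Sum>s<S. scaleW \<epsilon> (V' r (l + N r - int i) (U s (M s + int i) w)))"
        unfolding opp_u opp_v eq unfolding V'_def
        by (simp add: mode_sum mode_scale scale_sum_right \<epsilon>_def mult.commute)
      also have "\<dots> = (\<Sum>s<S. \<Sum>r<S. scaleW \<epsilon> (V' r (l + N r - int i) (U s (M s + int i) w)))"
        by (rule sum.swap)
      finally show ?thesis .
    qed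
    have uv: "opp u (m + int i) (opp v (l + n - int i) w) =
      (\<Sum>s<S. \<Sum>r<S. scaleW \<epsilon> (U s (l + M s - int i) (V' r (N r + int i) w)))" for i
    proof -
      have eq: "2 * a - int s - (m + int i) - 2 = l + M s - int i"
        "2 * b - int r - (l + n - int i) - 2 = N r + int i" for r s
        by (simp_all add: M_def N_def)
      show ?thesis
        unfolding opp_u opp_v eq unfolding U_def
        by (simp add: mode_sum mode_scale scale_sum_right \<epsilon>_def)
    qed
    have swap: "(\<Sum>i<K. \<Sum>s<S. \<Sum>r<S. f i s r) = (\<Sum>s<S. \<Sum>r<S. \<Sum>i<K. f i s r)"
      for f :: "nat \<Rightarrow> nat \<Rightarrow> nat \<Rightarrow> 'w"
      by (subst sum.swap, rule sum.cong[OF refl], rule sum.swap)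
    \<comment> \<open>As \<open>(-1) powi l\<close> is its own inverse, the factor inside
      \<open>B2\<close> can be compensated outside.\<close>
    have sq: "(-1) powi l * (-1) powi l = (1 :: complex)"
      by (simp add: power_int_minus_left)
    have first: "(\<Sum>i<K. scaleW ((-1) ^ i * (of_int l gchoose i)) (opp v (n + int i) (opp u (l + m - int i) w)))
      = (\<Sum>s<S. \<Sum>r<S. scaleW (\<epsilon> * (-1) powi l) (B2 s r))"
    proof -
      have "(-1) ^ i * (of_int l gchoose i) * \<epsilon> =
        \<epsilon> * (-1) powi l * ((-1) powi l * ((-1) ^ i * (of_int l gchoose i)))" for i
        using sq by (simp add: mult_ac)
      then show ?thesis
        unfolding vu B2_def scale_sum_right scale_scale swap by (simp only:)
    qed
    have second: "(\<Sum>i<K. scaleW ((-1) powi l * ((-1) ^ i * (of_int l gchoose i)))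
        (opp u (m + int i) (opp v (l + n - int i) w)))
      = (\<Sum>s<S. \<Sum>r<S. scaleW (\<epsilon> * (-1) powi l) (B1 s r))"
      unfolding uv B1_def scale_sum_right scale_scale swap by (simp only: mult_ac)
    have third: "(\<Sum>i<K. scaleW (of_int m gchoose i) (opp (YV u (l + int i) v) (m + n - int i) w))
      = (\<Sum>s<S. \<Sum>r<S. scaleW (- (\<epsilon> * (-1) powi l)) (B1 s r - B2 s r))"
    proof -
      have trunc: "YV (V.L1_divpow s u) (l + int q) (V.L1_divpow r v) = 0" if "q \<ge> K" for s q r
        using elim(1) S that by (cases "s < S"; cases "r < S") (auto simp: not_less)
      have "B1 s r - B2 s r = (\<Sum>i<K. scaleW (of_int (M s) gchoose i)
         (Y (YV (V.L1_divpow s u) (l + int i) (V.L1_divpow r v)) (M s + N r - int i) w))"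
        if "s < S" "r < S" for s r
        using elim(2) that unfolding B1_def B2_def by blast
      then show ?thesis
        by (subst borcherds_homogeneous_expansion[where S = S, OF u v])
          (auto simp only: S trunc lessThan_iff \<epsilon>_def M_def N_def intro!: sum.cong)
    qed
    show ?case
      unfolding first second third
      by (simp add: scale_right_diff_distrib sum_subtractf sum_negf)
  qed
qed

text \<open>Everything is additive in \<open>u\<close> and in \<open>v\<close>, and two eventual
  identities hold together eventually, so the homogeneous case suffices.\<close>

lemma opposite_borcherds:
  "\<forall>\<^sub>F K in sequentially.
    (\<Sum>i<K. scaleW ((-1) ^ i * (of_int l gchoose i)) (opp v (n + int i) (opp u (l + m - int i) w)))
    - (\<Sum>i<K. scaleW ((-1) powi l * ((-1) ^ i * (of_int l gchoose i)))
        (opp u (m + int i) (opp v (l + n - int i) w)))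
    = (\<Sum>i<K. scaleW (of_int m gchoose i) (opp (YV u (l + int i) v) (m + n - int i) w))"
proof (induction u rule: V.homogeneous_induct)
  case u: (1 a u)
  show ?case
  proof (induction v rule: V.homogeneous_induct)
    case (1 b v)
    show ?case by (rule opposite_borcherds_homogeneous[OF u 1])
  next
    case (2 v v')
    then show ?case
    proof eventually_elim
      case (elim K)
      then show ?case
        by (simp add: opp_add_left opp_add_right V.adjoint.mode_add scale_right_distrib sum.distrib
            algebra_simps)
    qed
  qed
next
  case (2 u u')
  then show ?case
  proof eventually_elim
    case (elim K)
    then show ?case
      by (simp add: opp_add_left opp_add_right V.adjoint.Y_add scale_right_distrib sum.distrib
          algebra_simps)
  qed
qed

text \<open>The case \<open>l = 0\<close>. The bound \<open>K\<close> depends only on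
  \<open>u\<close> and \<open>v\<close>, not on \<open>w\<close> or the modes; a larger
  \<open>k\<close> valid for the given \<open>w\<close> is chosen inside and the sum cut back to
  \<open>K\<close>.\<close>

lemma opposite_commutator:
  assumes K: "\<And>i. i \<ge> K \<Longrightarrow> YV u (int i) v = 0"
  shows "opp v n (opp u m w) - opp u m (opp v n w) =
    (\<Sum>i<K. scaleW (of_int m gchoose i) (opp (YV u (int i) v) (m + n - int i) w))"
proof -
  have "\<forall>\<^sub>F k in sequentially. K \<le> k \<and> 0 < k \<and>
    (\<Sum>i<k. scaleW ((-1) ^ i * (of_int 0 gchoose i)) (opp v (n + int i) (opp u (0 + m - int i) w)))
    - (\<Sum>i<k. scaleW ((-1) powi 0 * ((-1) ^ i * (of_int 0 gchoose i)))
        (opp u (m + int i) (opp v (0 + n - int i) w)))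
    = (\<Sum>i<k. scaleW (of_int m gchoose i) (opp (YV u (0 + int i) v) (m + n - int i) w))"
    by (intro eventually_conj eventually_ge_at_top eventually_gt_at_top opposite_borcherds)
  then obtain k where k: "K \<le> k" "0 < k" and eq:
    "(\<Sum>i<k. scaleW ((-1) ^ i * (of_int 0 gchoose i)) (opp v (n + int i) (opp u (0 + m - int i) w)))
    - (\<Sum>i<k. scaleW ((-1) powi 0 * ((-1) ^ i * (of_int 0 gchoose i)))
        (opp u (m + int i) (opp v (0 + n - int i) w)))
    = (\<Sum>i<k. scaleW (of_int m gchoose i) (opp (YV u (0 + int i) v) (m + n - int i) w))"
    using eventually_happens'[OF sequentially_bot] by blast
  have "(\<Sum>i<k. scaleW ((-1) ^ i * (of_int 0 gchoose i)) (f i)) = f 0" for f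
    using k(2) by (subst sum_lessThan_eq_sum[of 1]) (auto simp: gbinomial_0_left)
  moreover have "(\<Sum>i<k. scaleW (of_int m gchoose i) (opp (YV u (int i) v) (m + n - int i) w)) =
      (\<Sum>i<K. scaleW (of_int m gchoose i) (opp (YV u (int i) v) (m + n - int i) w))"
    by (rule sum_lessThan_eq_sum[OF k(1)]) (simp add: K)
  ultimately show ?thesis using eq by simp
qed

section \<open>The module \<open>D(W)\<close>\<close>

abbreviation "dual \<equiv> dual_vertex_map scaleV YV \<omega> Y"
abbreviation "DW \<equiv> D scaleV YV \<omega> scaleW Y"

section \<open>Linear functionals and closure of \<open>D(W)\<close> under the modes\<close>

lemma dual_space_iff:
  "\<alpha> \<in> dual_space scaleW \<longleftrightarrow>
    (\<forall>w w'. \<alpha> (w + w') = \<alpha> w + \<alpha> w') \<and> (\<forall>x w. \<alpha> (scaleW x w) = x * \<alpha> w)"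
proof -
  have "vector_space ((*) :: complex \<Rightarrow> complex \<Rightarrow> complex)"
    by standard (simp_all add: algebra_simps)
  then show ?thesis
    by (simp add: dual_space_def Vector_Spaces.linear_iff vector_space_axioms)
qed

lemma dual_space_0: "\<alpha> \<in> dual_space scaleW \<Longrightarrow> \<alpha> 0 = 0"
  unfolding dual_space_iff by (metis scale_zero_left mult_zero_left)

lemma DW_iff:
  "\<alpha> \<in> DW \<longleftrightarrow> \<alpha> \<in> dual_space scaleW \<and> (\<forall>v. \<exists>N. \<forall>n\<ge>N. dual v n \<alpha> = 0)"
  by (simp add: D_def)

lemma dual_space_sum:
  assumes "\<alpha> \<in> dual_space scaleW"
  shows "\<alpha> (\<Sum>i\<in>A. scaleW (x i) (f i)) = (\<Sum>i\<in>A. x i * \<alpha> (f i))"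
  using assms dual_space_0[OF assms]
  by (induction A rule: infinite_finite_induct) (auto simp: dual_space_iff)

lemma dual_space_diff:
  assumes "\<alpha> \<in> dual_space scaleW"
  shows "\<alpha> (w - w') = \<alpha> w - \<alpha> w'"
proof -
  have "\<alpha> (w - w') + \<alpha> w' = \<alpha> w"
    using assms unfolding dual_space_iff by (metis diff_add_cancel)
  then show ?thesis by (simp add: eq_diff_eq)
qed

lemma dual_0_right [simp]: "dual v n 0 = 0"
  by (simp add: dual_vertex_map_eq fun_eq_iff)

lemma dual_0_left: "\<alpha> \<in> dual_space scaleW \<Longrightarrow> dual 0 n \<alpha> = 0"
  by (simp add: dual_vertex_map_eq fun_eq_iff dual_space_0)

lemma dual_in_dual_space: "\<alpha> \<in> dual_space scaleW \<Longrightarrow> dual v n \<alpha> \<in> dual_space scaleW"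
  by (simp add: dual_space_iff dual_vertex_map_eq opp_add_right opp_scale_right)

text \<open>A functional in \<open>D(W)\<close> is applied to the commutator of the opposite modes
  \<open>v\<close> at \<open>k\<close> and \<open>u\<close> at \<open>n\<close>. For large
  \<open>k\<close> one product dies by truncation of \<open>\<alpha>\<close> at \<open>v\<close>,
  and the right side by truncation at the finitely many \<open>YV v (int i) u\<close>; so the other
  product dies too.\<close>

lemma dual_mem_DW:
  assumes "\<alpha> \<in> DW"
  shows "dual u n \<alpha> \<in> DW"
proof -
  have \<alpha>: "\<alpha> \<in> dual_space scaleW" and trunc: "\<And>v. \<exists>N. \<forall>n\<ge>N. dual v n \<alpha> = 0"
    using assms by (auto simp: DW_iff)
  have "\<exists>N. \<forall>k\<ge>N. dual v k (dual u n \<alpha>) = 0" for v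
  proof -
    obtain K0 where K0: "\<forall>k\<ge>K0. YV v k u = 0" using V.truncation by blast
    define K where "K = nat K0"
    have K: "YV v (int i) u = 0" if "i \<ge> K" for i
      using that K0 by (simp add: K_def)
    obtain N0 where N0: "\<And>k. k \<ge> N0 \<Longrightarrow> dual v k \<alpha> = 0" using trunc by blast
    have "\<forall>i. \<exists>N. \<forall>k\<ge>N. dual (YV v (int i) u) k \<alpha> = 0" using trunc by blast
    then obtain N1 where "\<forall>i. \<forall>k\<ge>N1 i. dual (YV v (int i) u) k \<alpha> = 0"
      by (rule choice[THEN exE])
    then have N1: "\<And>i k. k \<ge> N1 i \<Longrightarrow> dual (YV v (int i) u) k \<alpha> = 0" by blast
    \<comment> \<open>For \<open>i < K\<close>, the bound \<open>k \<ge> N1 i - n + i\<close> is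
      what puts the mode \<open>k + n - i\<close> beyond \<open>N1 i\<close>.\<close>
    define N where "N = Max (insert N0 ((\<lambda>i. N1 i - n + int i) ` {..<K}))"
    have "dual v k (dual u n \<alpha>) = 0" if "k \<ge> N" for k
    proof (rule ext)
      fix w
      have "k \<ge> N0" using that by (simp add: N_def)
      then have "\<alpha> (opp v k x) = 0" for x
        using N0 by (simp add: dual_vertex_map_eq fun_eq_iff)
      moreover have "\<alpha> (opp (YV v (int i) u) (k + n - int i) w) = 0" if "i < K" for i
      proof -
        have "N1 i - n + int i \<le> N" unfolding N_def using that by (intro Max_ge) auto
        then have "k + n - int i \<ge> N1 i" using \<open>k \<ge> N\<close> by simp
        then show ?thesis using N1 by (simp add: dual_vertex_map_eq fun_eq_iff)
      qed
      moreover have "opp u n (opp v k w) - opp v k (opp u n w) =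
          (\<Sum>i<K. scaleW (of_int k gchoose i) (opp (YV v (int i) u) (k + n - int i) w))"
        by (rule opposite_commutator) (rule K)
      then have "\<alpha> (opp u n (opp v k w)) - \<alpha> (opp v k (opp u n w)) =
          (\<Sum>i<K. (of_int k gchoose i) * \<alpha> (opp (YV v (int i) u) (k + n - int i) w))"
        by (simp flip: dual_space_diff[OF \<alpha>] dual_space_sum[OF \<alpha>])
      ultimately show "dual v k (dual u n \<alpha>) w = 0 w"
        by (simp add: dual_vertex_map_eq)
    qed
    then show ?thesis by blast
  qed
  then show ?thesis using \<alpha> by (simp add: DW_iff dual_in_dual_space)
qed

section \<open>The Jacobi identity and the remaining axioms on \<open>D(W)\<close>\<close>

lemma vector_space_dual_scale: "vector_space (dual_scale :: complex \<Rightarrow> ('w \<Rightarrow> complex) \<Rightarrow> _)"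
  by standard (auto simp: dual_scale_def fun_eq_iff algebra_simps)

text \<open>Evaluation at \<open>w\<close> turns the claim into \<open>\<alpha>\<close> applied to
  the opposite identity. Transposition reverses compositions, which restores the order of the Jacobi
  identity.\<close>

lemma dual_jacobi:
  assumes "\<alpha> \<in> DW"
  shows "jacobi_identity YV dual_scale dual u v \<alpha>"
  unfolding jacobi_identity_iff_borcherds[OF vector_space_dual_scale]
proof (intro allI)
  fix l m n
  interpret dual: vector_space "dual_scale :: complex \<Rightarrow> ('w \<Rightarrow> complex) \<Rightarrow> _"
    by (rule vector_space_dual_scale)
  have \<alpha>: "\<alpha> \<in> dual_space scaleW" using assms by (simp add: DW_iff)
  obtain N1 where N1: "\<And>k. k \<ge> N1 \<Longrightarrow> dual v k \<alpha> = 0" using assms by (auto simp: DW_iff)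
  obtain N2 where N2: "\<And>k. k \<ge> N2 \<Longrightarrow> dual u k \<alpha> = 0" using assms by (auto simp: DW_iff)
  obtain N3 where N3: "\<And>k. k \<ge> N3 \<Longrightarrow> YV u k v = 0" using V.truncation by blast
  \<comment> \<open>From \<open>K0\<close> on, the modes \<open>n + i\<close> of \<open>v\<close>
    and \<open>m + i\<close> of \<open>u\<close> kill \<open>\<alpha>\<close>, and
    \<open>YV u (l + int i) v\<close> vanishes; this bound does not involve
    \<open>w\<close>.\<close>
  define K0 where "K0 = nat (max (N1 - n) (max (N2 - m) (N3 - l)))"
  let ?F1 = "\<lambda>i. dual_scale ((-1) ^ i * (of_int l gchoose i))
    (dual u (l + m - int i) (dual v (n + int i) \<alpha>))"
  let ?F2 = "\<lambda>i. dual_scale ((-1) powi l * ((-1) ^ i * (of_int l gchoose i)))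
    (dual v (l + n - int i) (dual u (m + int i) \<alpha>))"
  let ?F3 = "\<lambda>i. dual_scale (of_int m gchoose i) (dual (YV u (l + int i) v) (m + n - int i) \<alpha>)"
  have zero: "?F1 i = 0" "?F2 i = 0" "?F3 i = 0" if "i \<ge> K0" for i
    using that N1[of "n + int i"] N2[of "m + int i"] N3[of "l + int i"]
    by (simp_all add: K0_def dual_0_left[OF \<alpha>])
  have sums: "Sum_any ?F1 = sum ?F1 {..<K}" "Sum_any ?F2 = sum ?F2 {..<K}" "Sum_any ?F3 = sum ?F3 {..<K}"
    if "K \<ge> K0" for K
    by (rule Sum_any_eq_sum_lessThan, rule zero, use that in simp)+
  show "Sum_any ?F1 - Sum_any ?F2 = Sum_any ?F3"
  proof (rule ext)
    fix w
    \<comment> \<open>This \<open>K\<close> depends on \<open>w\<close>, which is harmless: the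
      transposed partial sums are the same for every \<open>K \<ge> K0\<close>.\<close>
    obtain K where K: "K \<ge> K0" and eq:
      "(\<Sum>i<K. scaleW ((-1) ^ i * (of_int l gchoose i)) (opp v (n + int i) (opp u (l + m - int i) w)))
      - (\<Sum>i<K. scaleW ((-1) powi l * ((-1) ^ i * (of_int l gchoose i)))
          (opp u (m + int i) (opp v (l + n - int i) w)))
      = (\<Sum>i<K. scaleW (of_int m gchoose i) (opp (YV u (l + int i) v) (m + n - int i) w))"
      using eventually_happens'[OF sequentially_bot
          eventually_conj[OF eventually_ge_at_top[of K0] opposite_borcherds[of l v n u m w]]] by blast
    show "(Sum_any ?F1 - Sum_any ?F2) w = Sum_any ?F3 w"
      unfolding sums[OF K]
      unfolding fun_diff_def sum_fun_apply dual_vertex_map_eq dual_scale_def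
        dual_space_sum[OF \<alpha>, symmetric] dual_space_diff[OF \<alpha>, symmetric] eq ..
  qed
qed

lemma subspace_DW: "module.subspace dual_scale DW"
proof -
  interpret dual: vector_space "dual_scale :: complex \<Rightarrow> ('w \<Rightarrow> complex) \<Rightarrow> _"
    by (rule vector_space_dual_scale)
  show ?thesis
  proof (rule dual.subspaceI)
    show "0 \<in> DW" by (simp add: DW_iff dual_space_iff)
  next
    fix \<alpha> \<beta> assume *: "\<alpha> \<in> DW" "\<beta> \<in> DW"
    have "\<exists>N. \<forall>n\<ge>N. dual v n (\<alpha> + \<beta>) = 0" for v
    proof -
      obtain N1 N2 where "\<forall>n\<ge>N1. dual v n \<alpha> = 0" "\<forall>n\<ge>N2. dual v n \<beta> = 0"
        using * unfolding DW_iff by blast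
      then have "\<forall>n\<ge>max N1 N2. dual v n (\<alpha> + \<beta>) = 0"
        by (simp add: dual_vertex_map_eq fun_eq_iff)
      then show ?thesis by blast
    qed
    then show "\<alpha> + \<beta> \<in> DW" using * by (simp add: DW_iff dual_space_iff algebra_simps)
  next
    fix x \<alpha> assume *: "\<alpha> \<in> DW"
    have "\<exists>N. \<forall>n\<ge>N. dual v n (dual_scale x \<alpha>) = 0" for v
    proof -
      obtain N where "\<forall>n\<ge>N. dual v n \<alpha> = 0" using * unfolding DW_iff by blast
      then have "\<forall>n\<ge>N. dual v n (dual_scale x \<alpha>) = 0"
        by (simp add: dual_vertex_map_eq fun_eq_iff dual_scale_def)
      then show ?thesis by blast
    qed
    then show "dual_scale x \<alpha> \<in> DW"
      using * by (simp add: DW_iff dual_space_iff dual_scale_def algebra_simps)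
  qed
qed

lemma weak_module_DW: "weak_module scaleV YV vac dual_scale DW dual"
proof -
  interpret dual: vector_space "dual_scale :: complex \<Rightarrow> ('w \<Rightarrow> complex) \<Rightarrow> _"
    by (rule vector_space_dual_scale)
  show ?thesis
  proof
    fix \<alpha> \<beta> v v' n x
    assume \<alpha>: "\<alpha> \<in> DW"
    show "dual v n (\<alpha> + \<beta>) = dual v n \<alpha> + dual v n \<beta>"
      by (simp add: dual_vertex_map_eq fun_eq_iff)
    show "dual v n (dual_scale x \<alpha>) = dual_scale x (dual v n \<alpha>)"
      by (simp add: dual_vertex_map_eq dual_scale_def)
    show "dual (v + v') n \<alpha> = dual v n \<alpha> + dual v' n \<alpha>"
      using \<alpha> by (simp add: dual_vertex_map_eq fun_eq_iff opp_add_left DW_iff dual_space_iff)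
    show "dual (scaleV x v) n \<alpha> = dual_scale x (dual v n \<alpha>)"
      using \<alpha> by (simp add: dual_vertex_map_eq opp_scale_left DW_iff dual_space_iff dual_scale_def)
    show "dual vac n \<alpha> = (if n = - 1 then \<alpha> else 0)"
      using \<alpha> by (simp add: dual_vertex_map_eq fun_eq_iff opp_vacuum DW_iff dual_space_0)
  qed (use subspace_DW dual_mem_DW dual_jacobi in \<open>auto simp: DW_iff\<close>)
qed

end

theorem proposition2p8:
  fixes scaleV :: "complex \<Rightarrow> 'v::ab_group_add \<Rightarrow> 'v"
    and YV :: "'v \<Rightarrow> int \<Rightarrow> 'v \<Rightarrow> 'v"
    and vac \<omega> :: 'v
    and c :: complex
    and scaleW :: "complex \<Rightarrow> 'w::ab_group_add \<Rightarrow> 'w"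
    and Y :: "'v \<Rightarrow> int \<Rightarrow> 'w \<Rightarrow> 'w"
  assumes "vertex_operator_algebra scaleV YV vac \<omega> c"
    and "weak_module scaleV YV vac scaleW UNIV Y"
  shows "weak_module scaleV YV vac dual_scale
           (D scaleV YV \<omega> scaleW Y) (dual_vertex_map scaleV YV \<omega> Y)"
  using assms by (intro voa_module.weak_module_DW voa_module.intro)

end
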